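(* Let $H$ be a Hopf algebra over a field $\Bbbk$ and let $A$ be a left $H$-comodule algebra. If $H$ is pointed and $A$ is right $H$-simple, then every $M\in{}^H\mathfrak{M}_A$ is free as a (right) $A$-module.
   Context: Everything is over a field $\Bbbk$; no finite-dimensionality is assumed. A Hopf algebra is pointed if each of its simple subcoalgebras is one-dimensional. A left $H$-comodule algebra is an algebra $A$ that is a left $H$-comodule whose coaction $\rho_A\colon A\to H\otimes A$, $a\mapsto a_{(-1)}\otimes a_{(0)}$, is an algebra map. $A$ is right $H$-simple if $A\neq0$ and its only right ideals that are $H$-subcomodules are $0$ and $A$. ${}^H\mathfrak{M}_A$ is the category of left $H$-comodules $M$ that are also right $A$-modules with $\rho_M(ma)=m_{(-1)}a_{(-1)}\otimes m_{(0)}a_{(0)}$; morphisms are the $H$-comodule maps that are $A$-module maps. *)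

theory Defs
  imports Complex_Main "HOL-Library.Poly_Mapping"
begin

text \<open>
  A vector space is a type of class \<open>ab_group_add\<close> with an explicit scalar multiplication \<open>s\<close>
  satisfying \<open>vector_space s\<close>; all dimensions are arbitrary. Algebras use the sort
  \<open>{ring, monoid_mult}\<close> (unital associative rings, the zero ring allowed) rather than \<open>ring_1\<close>,
  which would force \<open>0 \<noteq> 1\<close>.
\<close>

section \<open>Tensor products\<close>

text \<open>
  A formal sum \<open>('v \<times> 'w) \<Rightarrow>\<^sub>0 'k\<close> is an element of the vector space with basis \<open>V \<times> W\<close>.
  \<open>V \<otimes> W\<close> is its quotient by the bilinearity relations, and an element of \<open>V \<otimes> W\<close> is a coset.
\<close>

definition fscale :: "'k::field \<Rightarrow> ('p \<Rightarrow>\<^sub>0 'k) \<Rightarrow> ('p \<Rightarrow>\<^sub>0 'k)" where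
  "fscale c = Poly_Mapping.map ((*) c)"

lemma lookup_fscale [simp]: "Poly_Mapping.lookup (fscale c x) p = c * Poly_Mapping.lookup x p"
  by (simp add: fscale_def Poly_Mapping.map.rep_eq when_def)

lemma vector_space_fscale: "vector_space fscale"
  by unfold_locales (auto intro!: poly_mapping_eqI simp: lookup_add algebra_simps)

type_synonym ('k, 'v, 'w) tensor = "(('v \<times> 'w) \<Rightarrow>\<^sub>0 'k) set"
type_synonym ('k, 'u, 'v, 'w) tensor3 = "(('u \<times> 'v \<times> 'w) \<Rightarrow>\<^sub>0 'k) set"

definition pure :: "'v \<Rightarrow> 'w \<Rightarrow> ('v \<times> 'w) \<Rightarrow>\<^sub>0 'k::field" where
  "pure v w = Poly_Mapping.single (v, w) 1"

definition pure3 :: "'u \<Rightarrow> 'v \<Rightarrow> 'w \<Rightarrow> ('u \<times> 'v \<times> 'w) \<Rightarrow>\<^sub>0 'k::field" where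
  "pure3 u v w = Poly_Mapping.single (u, v, w) 1"

definition tensor_rel ::
  "('k::field \<Rightarrow> 'v::ab_group_add \<Rightarrow> 'v) \<Rightarrow> ('k \<Rightarrow> 'w::ab_group_add \<Rightarrow> 'w) \<Rightarrow> (('v \<times> 'w) \<Rightarrow>\<^sub>0 'k) set"
  where
  "tensor_rel sV sW = module.span fscale
     ({pure (v + v') w - pure v w - pure v' w | v v' w. True} \<union>
      {pure v (w + w') - pure v w - pure v w' | v w w'. True} \<union>
      {pure (sV c v) w - fscale c (pure v w) | c v w. True} \<union>
      {pure v (sW c w) - fscale c (pure v w) | c v w. True})"

definition tensor3_rel ::
  "('k::field \<Rightarrow> 'u::ab_group_add \<Rightarrow> 'u) \<Rightarrow> ('k \<Rightarrow> 'v::ab_group_add \<Rightarrow> 'v) \<Rightarrow>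
   ('k \<Rightarrow> 'w::ab_group_add \<Rightarrow> 'w) \<Rightarrow> (('u \<times> 'v \<times> 'w) \<Rightarrow>\<^sub>0 'k) set"
  where
  "tensor3_rel sU sV sW = module.span fscale
     ({pure3 (u + u') v w - pure3 u v w - pure3 u' v w | u u' v w. True} \<union>
      {pure3 u (v + v') w - pure3 u v w - pure3 u v' w | u v v' w. True} \<union>
      {pure3 u v (w + w') - pure3 u v w - pure3 u v w' | u v w w'. True} \<union>
      {pure3 (sU c u) v w - fscale c (pure3 u v w) | c u v w. True} \<union>
      {pure3 u (sV c v) w - fscale c (pure3 u v w) | c u v w. True} \<union>
      {pure3 u v (sW c w) - fscale c (pure3 u v w) | c u v w. True})"

definition tensor_class ::
  "('k::field \<Rightarrow> 'v::ab_group_add \<Rightarrow> 'v) \<Rightarrow> ('k \<Rightarrow> 'w::ab_group_add \<Rightarrow> 'w) \<Rightarrow>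
   (('v \<times> 'w) \<Rightarrow>\<^sub>0 'k) \<Rightarrow> ('k, 'v, 'w) tensor"
  where
  "tensor_class sV sW x = {y. y - x \<in> tensor_rel sV sW}"

definition tensor3_class ::
  "('k::field \<Rightarrow> 'u::ab_group_add \<Rightarrow> 'u) \<Rightarrow> ('k \<Rightarrow> 'v::ab_group_add \<Rightarrow> 'v) \<Rightarrow>
   ('k \<Rightarrow> 'w::ab_group_add \<Rightarrow> 'w) \<Rightarrow> (('u \<times> 'v \<times> 'w) \<Rightarrow>\<^sub>0 'k) \<Rightarrow> ('k, 'u, 'v, 'w) tensor3"
  where
  "tensor3_class sU sV sW x = {y. y - x \<in> tensor3_rel sU sV sW}"

text \<open>For subspaces \<open>C\<close>, \<open>D\<close>, this is the image of \<open>C \<otimes> D\<close> in \<open>V \<otimes> W\<close>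
  (isomorphic to \<open>C \<otimes> D\<close>, since everything is over a field).\<close>

definition tensor_sub ::
  "('k::field \<Rightarrow> 'v::ab_group_add \<Rightarrow> 'v) \<Rightarrow> ('k \<Rightarrow> 'w::ab_group_add \<Rightarrow> 'w) \<Rightarrow>
   'v set \<Rightarrow> 'w set \<Rightarrow> ('k, 'v, 'w) tensor set"
  where
  "tensor_sub sV sW C D = tensor_class sV sW ` {x. Poly_Mapping.keys x \<subseteq> C \<times> D}"

abbreviation tensor_space ::
  "('k::field \<Rightarrow> 'v::ab_group_add \<Rightarrow> 'v) \<Rightarrow> ('k \<Rightarrow> 'w::ab_group_add \<Rightarrow> 'w) \<Rightarrow> ('k, 'v, 'w) tensor set"
  where
  "tensor_space sV sW \<equiv> tensor_sub sV sW UNIV UNIV"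

text \<open>The operations below work on a chosen representative; the classes they are used to form
  do not depend on the choice.\<close>

definition tensor_rep :: "('k::field, 'v, 'w) tensor \<Rightarrow> ('v \<times> 'w) \<Rightarrow>\<^sub>0 'k" where
  "tensor_rep t = (SOME x. x \<in> t)"

definition tensor_add ::
  "('k::field \<Rightarrow> 'v::ab_group_add \<Rightarrow> 'v) \<Rightarrow> ('k \<Rightarrow> 'w::ab_group_add \<Rightarrow> 'w) \<Rightarrow>
   ('k, 'v, 'w) tensor \<Rightarrow> ('k, 'v, 'w) tensor \<Rightarrow> ('k, 'v, 'w) tensor"
  where
  "tensor_add sV sW t t' = tensor_class sV sW (tensor_rep t + tensor_rep t')"

definition tensor_scale ::
  "('k::field \<Rightarrow> 'v::ab_group_add \<Rightarrow> 'v) \<Rightarrow> ('k \<Rightarrow> 'w::ab_group_add \<Rightarrow> 'w) \<Rightarrow>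
   'k \<Rightarrow> ('k, 'v, 'w) tensor \<Rightarrow> ('k, 'v, 'w) tensor"
  where
  "tensor_scale sV sW c t = tensor_class sV sW (fscale c (tensor_rep t))"

text \<open>\<open>tensor_lift s \<beta> t\<close> is the value at \<open>t\<close> of the linear map \<open>V \<otimes> W \<rightarrow> U\<close> induced by a bilinear
  map \<open>\<beta> : V \<times> W \<rightarrow> U\<close>, that is, the Sweedler sum of \<open>\<beta> t\<^sub>1 t\<^sub>2\<close>; \<open>s\<close> is the scalar multiplication of
  \<open>U\<close>. When the target is itself a tensor product, \<open>\<beta>\<close> and the result are given by formal sums
  representing its elements (so \<open>\<beta>\<close> is bilinear only modulo the relations), with \<open>s = fscale\<close>.\<close>

definition tensor_lift ::
  "('k::field \<Rightarrow> 'u::ab_group_add \<Rightarrow> 'u) \<Rightarrow> ('v \<Rightarrow> 'w \<Rightarrow> 'u) \<Rightarrow> ('k, 'v, 'w) tensor \<Rightarrow> 'u"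
  where
  "tensor_lift s \<beta> t =
     (\<Sum>(v, w)\<in>Poly_Mapping.keys (tensor_rep t). s (Poly_Mapping.lookup (tensor_rep t) (v, w)) (\<beta> v w))"

lemma tensor_lift_tensor_class:
  fixes sV :: "'k::field \<Rightarrow> 'v::ab_group_add \<Rightarrow> 'v" and sW :: "'k \<Rightarrow> 'w::ab_group_add \<Rightarrow> 'w"
    and s :: "'k \<Rightarrow> 'u::ab_group_add \<Rightarrow> 'u"
  assumes "vector_space s"
    and addl: "\<And>v v' w. \<beta> (v + v') w = \<beta> v w + \<beta> v' w"
    and addr: "\<And>v w w'. \<beta> v (w + w') = \<beta> v w + \<beta> v w'"
    and scl: "\<And>c v w. \<beta> (sV c v) w = s c (\<beta> v w)"
    and scr: "\<And>c v w. \<beta> v (sW c w) = s c (\<beta> v w)"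
  shows "tensor_lift s \<beta> (tensor_class sV sW x) =
    (\<Sum>(v, w)\<in>Poly_Mapping.keys x. s (Poly_Mapping.lookup x (v, w)) (\<beta> v w))"
proof -
  interpret vector_space s by fact
  interpret F: vector_space fscale by (rule vector_space_fscale)
  let ?e = "\<lambda>x. \<Sum>(v, w)\<in>Poly_Mapping.keys x. s (Poly_Mapping.lookup x (v, w)) (\<beta> v w)"
  have sup: "?e x = (\<Sum>(v, w)\<in>T. s (Poly_Mapping.lookup x (v, w)) (\<beta> v w))"
    if "finite T" "Poly_Mapping.keys x \<subseteq> T" for x T
    by (rule sum.mono_neutral_left) (use that in \<open>auto simp: in_keys_iff\<close>)
  have add: "?e (x + y) = ?e x + ?e y" for x y
  proof -
    let ?T = "Poly_Mapping.keys x \<union> Poly_Mapping.keys y"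
    have "?e (x + y) = (\<Sum>(v, w)\<in>?T. s (Poly_Mapping.lookup (x+y) (v, w)) (\<beta> v w))"
      by (rule sup) (auto simp: keys_add)
    also have "\<dots> = (\<Sum>(v, w)\<in>?T. s (Poly_Mapping.lookup x (v, w)) (\<beta> v w)) + (\<Sum>(v, w)\<in>?T. s (Poly_Mapping.lookup y (v, w)) (\<beta> v w))"
      by (simp add: lookup_add scale_left_distrib sum.distrib case_prod_unfold)
    also have "\<dots> = ?e x + ?e y"
      using sup[of ?T x] sup[of ?T y] by simp
    finally show ?thesis .
  qed
  have sc: "?e (fscale c x) = s c (?e x)" for c x
  proof -
    have "?e (fscale c x) = (\<Sum>(v, w)\<in>Poly_Mapping.keys x. s (Poly_Mapping.lookup (fscale c x) (v, w)) (\<beta> v w))"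
      by (rule sup) (auto simp: in_keys_iff)
    then show ?thesis by (simp add: scale_sum_right case_prod_unfold)
  qed
  have pure: "?e (pure v w) = \<beta> v w" for v w
    by (simp add: pure_def)
  have diff: "?e (x - y) = ?e x - ?e y" for x y
    using add[of "x - y" y] by (simp add: algebra_simps)
  have rel: "?e r = 0" if "r \<in> tensor_rel sV sW" for r
    using that unfolding tensor_rel_def
  proof (induction rule: F.span_induct_alt)
    case base show ?case by simp
  next
    case (step c x y)
    have "?e x = 0" using step(1)
      by (auto simp only: Un_iff mem_Collect_eq diff pure sc addl addr scl scr) (auto simp: algebra_simps)
    then show ?case using step(2) by (simp only: add sc) simp
  qed
  have "tensor_rep (tensor_class sV sW x) \<in> tensor_class sV sW x"
    unfolding tensor_rep_def
    by (rule someI[of _ x]) (simp add: tensor_class_def tensor_rel_def F.span_zero)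
  then have "?e (tensor_rep (tensor_class sV sW x) - x) = 0"
    by (intro rel) (simp add: tensor_class_def)
  then show ?thesis by (simp add: diff tensor_lift_def)
qed

definition linear_into_tensor ::
  "('k::field \<Rightarrow> 'm::ab_group_add \<Rightarrow> 'm) \<Rightarrow> ('k \<Rightarrow> 'v::ab_group_add \<Rightarrow> 'v) \<Rightarrow>
   ('k \<Rightarrow> 'w::ab_group_add \<Rightarrow> 'w) \<Rightarrow> ('m \<Rightarrow> ('k, 'v, 'w) tensor) \<Rightarrow> bool"
  where
  "linear_into_tensor sM sV sW f \<longleftrightarrow>
     range f \<subseteq> tensor_space sV sW \<and>
     (\<forall>x y. f (x + y) = tensor_add sV sW (f x) (f y)) \<and>
     (\<forall>c x. f (sM c x) = tensor_scale sV sW c (f x))"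

text \<open>\<open>(v \<otimes> w) \<cdot> (v' \<otimes> w') = f v v' \<otimes> g w w'\<close>, for bilinear \<open>f\<close>, \<open>g\<close> with values in \<open>V\<close>, \<open>W\<close>. It gives both
  the product of a tensor product of algebras and the action of \<open>H \<otimes> A\<close> on \<open>H \<otimes> M\<close>.\<close>

definition tensor_mult ::
  "('k::field \<Rightarrow> 'v::ab_group_add \<Rightarrow> 'v) \<Rightarrow> ('k \<Rightarrow> 'w::ab_group_add \<Rightarrow> 'w) \<Rightarrow>
   ('v \<Rightarrow> 'v1 \<Rightarrow> 'v) \<Rightarrow> ('w \<Rightarrow> 'w1 \<Rightarrow> 'w) \<Rightarrow>
   ('k, 'v, 'w) tensor \<Rightarrow> ('k, 'v1, 'w1) tensor \<Rightarrow> ('k, 'v, 'w) tensor"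
  where
  "tensor_mult sV sW f g t t' = tensor_class sV sW
     (tensor_lift fscale (\<lambda>v w. tensor_lift fscale (\<lambda>v' w'. pure (f v v') (g w w')) t') t)"


section \<open>Algebras, coalgebras, comodules\<close>

locale k_algebra = vector_space s
  for s :: "'k::field \<Rightarrow> 'a::{ring,monoid_mult} \<Rightarrow> 'a" +
  assumes scale_mult_left: "s c (x * y) = s c x * y"
    and scale_mult_right: "s c (x * y) = x * s c y"

text \<open>\<open>(\<Delta> \<otimes> id)(t)\<close> and \<open>(id \<otimes> \<rho>)(t)\<close> in \<open>C \<otimes> C \<otimes> M\<close>, for \<open>t\<close> in \<open>C \<otimes> M\<close>.\<close>

definition comult_tensor_id ::
  "('k::field \<Rightarrow> 'c::ab_group_add \<Rightarrow> 'c) \<Rightarrow> ('k \<Rightarrow> 'm::ab_group_add \<Rightarrow> 'm) \<Rightarrow>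
   ('c \<Rightarrow> ('k, 'c, 'c) tensor) \<Rightarrow> ('k, 'c, 'm) tensor \<Rightarrow> ('k, 'c, 'c, 'm) tensor3"
  where
  "comult_tensor_id sC sM \<Delta> t = tensor3_class sC sC sM
     (tensor_lift fscale (\<lambda>c m. tensor_lift fscale (\<lambda>a b. pure3 a b m) (\<Delta> c)) t)"

definition id_tensor_coact ::
  "('k::field \<Rightarrow> 'c::ab_group_add \<Rightarrow> 'c) \<Rightarrow> ('k \<Rightarrow> 'm::ab_group_add \<Rightarrow> 'm) \<Rightarrow>
   ('m \<Rightarrow> ('k, 'c, 'm) tensor) \<Rightarrow> ('k, 'c, 'm) tensor \<Rightarrow> ('k, 'c, 'c, 'm) tensor3"
  where
  "id_tensor_coact sC sM \<rho> t = tensor3_class sC sC sM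
     (tensor_lift fscale (\<lambda>c m. tensor_lift fscale (\<lambda>a b. pure3 c a b) (\<rho> m)) t)"

locale coalgebra = vector_space s
  for s :: "'k::field \<Rightarrow> 'c::ab_group_add \<Rightarrow> 'c" +
  fixes \<Delta> :: "'c \<Rightarrow> ('k, 'c, 'c) tensor" and \<epsilon> :: "'c \<Rightarrow> 'k"
  assumes comult_linear: "linear_into_tensor s s s \<Delta>"
    and counit_linear: "Vector_Spaces.linear s (*) \<epsilon>"
    and coassoc: "comult_tensor_id s s \<Delta> (\<Delta> x) = id_tensor_coact s s \<Delta> (\<Delta> x)"
    and counit_left: "tensor_lift s (\<lambda>a b. s (\<epsilon> a) b) (\<Delta> x) = x"
    and counit_right: "tensor_lift s (\<lambda>a b. s (\<epsilon> b) a) (\<Delta> x) = x"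

locale hopf_algebra = k_algebra s + coalgebra s \<Delta> \<epsilon>
  for s :: "'k::field \<Rightarrow> 'h::{ring,monoid_mult} \<Rightarrow> 'h"
    and \<Delta> :: "'h \<Rightarrow> ('k, 'h, 'h) tensor" and \<epsilon> :: "'h \<Rightarrow> 'k" +
  fixes S :: "'h \<Rightarrow> 'h"
  assumes comult_mult: "\<Delta> (x * y) = tensor_mult s s (*) (*) (\<Delta> x) (\<Delta> y)"
    and comult_one: "\<Delta> 1 = tensor_class s s (pure 1 1)"
    and counit_mult: "\<epsilon> (x * y) = \<epsilon> x * \<epsilon> y"
    and counit_one: "\<epsilon> 1 = 1"
    and antipode_linear: "Vector_Spaces.linear s s S"
    and antipode_left: "tensor_lift s (\<lambda>a b. S a * b) (\<Delta> x) = s (\<epsilon> x) 1"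
    and antipode_right: "tensor_lift s (\<lambda>a b. a * S b) (\<Delta> x) = s (\<epsilon> x) 1"

locale left_comodule = C: coalgebra sC \<Delta> \<epsilon> + M: vector_space sM
  for sC :: "'k::field \<Rightarrow> 'c::ab_group_add \<Rightarrow> 'c"
    and \<Delta> :: "'c \<Rightarrow> ('k, 'c, 'c) tensor" and \<epsilon> :: "'c \<Rightarrow> 'k"
    and sM :: "'k \<Rightarrow> 'm::ab_group_add \<Rightarrow> 'm" +
  fixes \<rho> :: "'m \<Rightarrow> ('k, 'c, 'm) tensor"
  assumes coact_linear: "linear_into_tensor sM sC sM \<rho>"
    and coact_coassoc: "comult_tensor_id sC sM \<Delta> (\<rho> m) = id_tensor_coact sC sM \<rho> (\<rho> m)"
    and coact_counit: "tensor_lift sM (\<lambda>c n. sM (\<epsilon> c) n) (\<rho> m) = m"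

locale left_comodule_algebra =
  H: hopf_algebra sH \<Delta> \<epsilon> S + A: k_algebra sA + left_comodule sH \<Delta> \<epsilon> sA \<rho>
  for sH :: "'k::field \<Rightarrow> 'h::{ring,monoid_mult} \<Rightarrow> 'h"
    and \<Delta> :: "'h \<Rightarrow> ('k, 'h, 'h) tensor" and \<epsilon> :: "'h \<Rightarrow> 'k" and S :: "'h \<Rightarrow> 'h"
    and sA :: "'k \<Rightarrow> 'a::{ring,monoid_mult} \<Rightarrow> 'a"
    and \<rho> :: "'a \<Rightarrow> ('k, 'h, 'a) tensor" +
  assumes coact_mult: "\<rho> (a * b) = tensor_mult sH sA (*) (*) (\<rho> a) (\<rho> b)"
    and coact_one: "\<rho> 1 = tensor_class sH sA (pure 1 1)"


section \<open>Pointedness and right simplicity\<close>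

definition subcoalgebra ::
  "('k::field \<Rightarrow> 'c::ab_group_add \<Rightarrow> 'c) \<Rightarrow> ('c \<Rightarrow> ('k, 'c, 'c) tensor) \<Rightarrow> 'c set \<Rightarrow> bool"
  where
  "subcoalgebra s \<Delta> C \<longleftrightarrow> module.subspace s C \<and> \<Delta> ` C \<subseteq> tensor_sub s s C C"

definition simple_subcoalgebra ::
  "('k::field \<Rightarrow> 'c::ab_group_add \<Rightarrow> 'c) \<Rightarrow> ('c \<Rightarrow> ('k, 'c, 'c) tensor) \<Rightarrow> 'c set \<Rightarrow> bool"
  where
  "simple_subcoalgebra s \<Delta> C \<longleftrightarrow> subcoalgebra s \<Delta> C \<and> C \<noteq> {0} \<and>
     (\<forall>D. subcoalgebra s \<Delta> D \<and> D \<subseteq> C \<longrightarrow> D = {0} \<or> D = C)"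

definition pointed ::
  "('k::field \<Rightarrow> 'c::ab_group_add \<Rightarrow> 'c) \<Rightarrow> ('c \<Rightarrow> ('k, 'c, 'c) tensor) \<Rightarrow> bool"
  where
  "pointed s \<Delta> \<longleftrightarrow> (\<forall>C. simple_subcoalgebra s \<Delta> C \<longrightarrow> vector_space.dim s C = 1)"

definition subcomodule ::
  "('k::field \<Rightarrow> 'c::ab_group_add \<Rightarrow> 'c) \<Rightarrow> ('k \<Rightarrow> 'm::ab_group_add \<Rightarrow> 'm) \<Rightarrow>
   ('m \<Rightarrow> ('k, 'c, 'm) tensor) \<Rightarrow> 'm set \<Rightarrow> bool"
  where
  "subcomodule sC sM \<rho> N \<longleftrightarrow> module.subspace sM N \<and> \<rho> ` N \<subseteq> tensor_sub sC sM UNIV N"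

definition right_ideal :: "'a::{ring,monoid_mult} set \<Rightarrow> bool" where
  "right_ideal I \<longleftrightarrow> 0 \<in> I \<and> (\<forall>x\<in>I. \<forall>y\<in>I. x - y \<in> I) \<and> (\<forall>x\<in>I. \<forall>a. x * a \<in> I)"

definition right_H_simple ::
  "('k::field \<Rightarrow> 'h::ab_group_add \<Rightarrow> 'h) \<Rightarrow> ('k \<Rightarrow> 'a::{ring,monoid_mult} \<Rightarrow> 'a) \<Rightarrow>
   ('a \<Rightarrow> ('k, 'h, 'a) tensor) \<Rightarrow> bool"
  where
  "right_H_simple sH sA \<rho> \<longleftrightarrow> (UNIV :: 'a set) \<noteq> {0} \<and>
     (\<forall>I. right_ideal I \<and> subcomodule sH sA \<rho> I \<longrightarrow> I = {0} \<or> I = UNIV)"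


section \<open>Relative Hopf modules\<close>

locale right_module =
  fixes act :: "'m::ab_group_add \<Rightarrow> 'a::{ring,monoid_mult} \<Rightarrow> 'm"
  assumes act_add_left: "act (m + n) a = act m a + act n a"
    and act_add_right: "act m (a + b) = act m a + act m b"
    and act_mult: "act m (a * b) = act (act m a) b"
    and act_one: "act m 1 = m"

text \<open>Objects of the category of left \<open>H\<close>-comodules and right \<open>A\<close>-modules; the vector space structure
  underlying the comodule is the one induced by the \<open>A\<close>-module (\<open>act_scale\<close>).\<close>

locale relative_hopf_module =
  left_comodule_algebra sH \<Delta> \<epsilon> S sA \<rho>A + M: left_comodule sH \<Delta> \<epsilon> sM \<rho>M + right_module act
  for sH :: "'k::field \<Rightarrow> 'h::{ring,monoid_mult} \<Rightarrow> 'h"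
    and \<Delta> :: "'h \<Rightarrow> ('k, 'h, 'h) tensor" and \<epsilon> :: "'h \<Rightarrow> 'k" and S :: "'h \<Rightarrow> 'h"
    and sA :: "'k \<Rightarrow> 'a::{ring,monoid_mult} \<Rightarrow> 'a"
    and \<rho>A :: "'a \<Rightarrow> ('k, 'h, 'a) tensor"
    and sM :: "'k \<Rightarrow> 'm::ab_group_add \<Rightarrow> 'm"
    and \<rho>M :: "'m \<Rightarrow> ('k, 'h, 'm) tensor"
    and act :: "'m \<Rightarrow> 'a \<Rightarrow> 'm" +
  assumes act_scale: "act m (sA c 1) = sM c m"
    and coact_act: "\<rho>M (act m a) = tensor_mult sH sM (*) act (\<rho>M m) (\<rho>A a)"

definition right_basis :: "('m::ab_group_add \<Rightarrow> 'a::{ring,monoid_mult} \<Rightarrow> 'm) \<Rightarrow> 'm set \<Rightarrow> bool" where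
  "right_basis act B \<longleftrightarrow>
     (\<forall>m. \<exists>!c. Poly_Mapping.keys c \<subseteq> B \<and> m = (\<Sum>b\<in>Poly_Mapping.keys c. act b (Poly_Mapping.lookup c b)))"

definition free_right_module :: "('m::ab_group_add \<Rightarrow> 'a::{ring,monoid_mult} \<Rightarrow> 'm) \<Rightarrow> bool" where
  "free_right_module act \<longleftrightarrow> (\<exists>B. right_basis act B)"

end

theory Submission
  imports Defs
begin

text \<open>
  Write \<open>G\<close> for the group-like elements of \<open>H\<close>. If \<open>N \<noteq> M\<close> is a subobject of \<open>M\<close>, pointedness gives
  \<open>w \<notin> N\<close> and \<open>g \<in> G\<close> with \<open>\<rho>(w) \<in> g \<otimes> w + H \<otimes> N\<close>. Since \<open>g\<close> is invertible, \<open>{a. w a \<in> N}\<close> is then a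
  costable right ideal not containing \<open>1\<close>, hence zero, so that \<open>(w A + N) / N\<close> is free on \<open>w\<close>.
  By Zorn's lemma there is a maximal \<open>A\<close>-independent set whose \<open>A\<close>-span is a subobject; it spans \<open>M\<close>.

  To find \<open>w\<close>, take a finite-dimensional subcomodule \<open>V \<not>\<subseteq> N\<close> of minimal dimension. The coefficients
  \<open>v_{-1} \<phi>(v_0)\<close> of \<open>V\<close>, with \<open>\<phi>\<close> vanishing on \<open>N\<close>, span a finite-dimensional subcoalgebra \<open>C\<close>, which contains
  some \<open>g \<in> G\<close>. If \<open>U \<subseteq> C\<close> is maximal among the left coideals avoiding \<open>g\<close>, then
  \<open>g = u + w_{-1} \<phi>(w_0)\<close> with \<open>u \<in> U\<close>, and this \<open>w\<close> does the job by minimality of \<open>V\<close>.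
\<close>

section \<open>Linear extension and universal properties of tensor products\<close>

text \<open>Linear extension from the basis of formal sums. It takes a formal sum rather than a
  coset, so computing with it involves no chosen representative.\<close>

definition lin_ext :: "('k::field \<Rightarrow> 'u::ab_group_add \<Rightarrow> 'u) \<Rightarrow> ('p \<Rightarrow> 'u) \<Rightarrow> ('p \<Rightarrow>\<^sub>0 'k) \<Rightarrow> 'u" where
  "lin_ext s \<beta> x = (\<Sum>p\<in>Poly_Mapping.keys x. s (Poly_Mapping.lookup x p) (\<beta> p))"

lemma vector_space_self: "vector_space ((*) :: 'k::field \<Rightarrow> 'k \<Rightarrow> 'k)"
  by unfold_locales (auto simp: algebra_simps)

lemma linear_fscaleI:
  assumes "vector_space s" "\<And>x y. f (x + y) = f x + f y" "\<And>c x. f (fscale c x) = s c (f x)"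
  shows "Vector_Spaces.linear fscale s f"
  using assms vector_space_fscale by (simp add: Vector_Spaces.linear_iff vector_space_pair_def)

lemma linear_lin_ext:
  assumes "vector_space s"
  shows "Vector_Spaces.linear fscale s (lin_ext s \<beta>)"
proof (rule linear_fscaleI[OF assms])
  interpret vector_space s by fact
  have sup: "lin_ext s \<beta> x = (\<Sum>p\<in>T. s (Poly_Mapping.lookup x p) (\<beta> p))"
    if "finite T" "Poly_Mapping.keys x \<subseteq> T" for x T
    unfolding lin_ext_def by (rule sum.mono_neutral_left) (use that in \<open>auto simp: in_keys_iff\<close>)
  show "lin_ext s \<beta> (x + y) = lin_ext s \<beta> x + lin_ext s \<beta> y" for x y
    using sup[of "Poly_Mapping.keys x \<union> Poly_Mapping.keys y"] keys_add[of x y]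
    by (simp add: lookup_add scale_left_distrib sum.distrib)
  show "lin_ext s \<beta> (fscale c x) = s c (lin_ext s \<beta> x)" for c x
    using sup[of "Poly_Mapping.keys x" "fscale c x"]
    by (simp add: lin_ext_def scale_sum_right subset_iff in_keys_iff)
qed

lemma lin_ext_single:
  assumes "vector_space s"
  shows "lin_ext s \<beta> (Poly_Mapping.single p c) = s c (\<beta> p)"
proof -
  interpret vector_space s by fact
  show ?thesis by (simp add: lin_ext_def)
qed

lemma linear_commutes_lin_ext:
  assumes "Vector_Spaces.linear s s' L"
  shows "L (lin_ext s \<beta> x) = lin_ext s' (\<lambda>p. L (\<beta> p)) x"
proof -
  interpret L: Vector_Spaces.linear s s' L by fact
  show ?thesis by (simp add: lin_ext_def L.sum L.scale)
qed

lemma lin_ext_nested: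
  assumes "vector_space s"
  shows "lin_ext s \<gamma> (lin_ext fscale \<delta> x) = lin_ext s (\<lambda>p. lin_ext s \<gamma> (\<delta> p)) x"
  by (rule linear_commutes_lin_ext[OF linear_lin_ext[OF assms]])

lemma lin_ext_mem:
  assumes "vector_space s" "module.subspace s N" "\<And>p. p \<in> Poly_Mapping.keys x \<Longrightarrow> \<beta> p \<in> N"
  shows "lin_ext s \<beta> x \<in> N"
proof -
  interpret vector_space s by fact
  show ?thesis unfolding lin_ext_def by (intro subspace_sum subspace_scale assms)
qed

lemma tensor_lift_lin_ext: "tensor_lift s \<beta> t = lin_ext s (\<lambda>p. \<beta> (fst p) (snd p)) (tensor_rep t)"
  by (simp add: tensor_lift_def lin_ext_def case_prod_unfold)

definition bilin where
  "bilin sV sW s \<beta> \<longleftrightarrow> (\<forall>w. Vector_Spaces.linear sV s (\<lambda>v. \<beta> v w)) \<and> (\<forall>v. Vector_Spaces.linear sW s (\<beta> v))"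

lemma linear_D:
  assumes "Vector_Spaces.linear s s' f"
  shows "f (x + y) = f x + f y" "f (s c x) = s' c (f x)" "f (x - y) = f x - f y" "f 0 = 0"
    "vector_space s" "vector_space s'"
proof -
  interpret Vector_Spaces.linear s s' f by fact
  show "f (x + y) = f x + f y" "f (s c x) = s' c (f x)" "f (x - y) = f x - f y" "f 0 = 0"
    by (rule add scale diff zero)+
  show "vector_space s" "vector_space s'" by unfold_locales
qed

text \<open>Bilinearity makes the value independent of the representative that
  \<open>tensor_rep\<close> picks.\<close>

lemma tensor_lift_class:
  assumes "bilin sV sW s \<beta>"
  shows "tensor_lift s \<beta> (tensor_class sV sW x) = lin_ext s (\<lambda>p. \<beta> (fst p) (snd p)) x"
proof -
  have v: "vector_space s" using assms unfolding bilin_def by (blast dest: linear_D(6))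
  have a: "Vector_Spaces.linear sV s (\<lambda>v. \<beta> v w)" "Vector_Spaces.linear sW s (\<beta> v)" for v w
    using assms by (auto simp: bilin_def)
  show ?thesis
    by (subst tensor_lift_tensor_class[OF v]) (use a[THEN linear_D(1)] a[THEN linear_D(2)] in
      \<open>auto simp: lin_ext_def case_prod_unfold\<close>)
qed

lemma (in module) coset_eq_iff:
  assumes "subspace R"
  shows "{z. z - x \<in> R} = {z. z - y \<in> R} \<longleftrightarrow> x - y \<in> R"
proof
  have "x \<in> {z. z - x \<in> R}" using subspace_0[OF assms] by simp
  then show "x - y \<in> R" if "{z. z - x \<in> R} = {z. z - y \<in> R}" using that by blast
next
  assume "x - y \<in> R"
  then have "z - x \<in> R \<longleftrightarrow> z - y \<in> R" for z
    using subspace_add[OF assms, of "z - x" "x - y"] subspace_diff[OF assms, of "z - y" "x - y"] by auto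
  then show "{z. z - x \<in> R} = {z. z - y \<in> R}" by simp
qed

lemma module_fscale: "module fscale"
  using vector_space_fscale by (rule module_iff_vector_space[THEN iffD2])

lemma subspace_tensor_rel: "module.subspace fscale (tensor_rel sV sW)"
  unfolding tensor_rel_def by (rule module.subspace_span[OF module_fscale])

lemma tensor_class_eq_iff: "tensor_class sV sW x = tensor_class sV sW y \<longleftrightarrow> x - y \<in> tensor_rel sV sW"
  unfolding tensor_class_def by (rule module.coset_eq_iff[OF module_fscale subspace_tensor_rel])

lemma tensor3_class_eq_iff:
  "tensor3_class sU sV sW x = tensor3_class sU sV sW y \<longleftrightarrow> x - y \<in> tensor3_rel sU sV sW"
  unfolding tensor3_class_def tensor3_rel_def
  by (rule module.coset_eq_iff[OF module_fscale module.subspace_span[OF module_fscale]])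

lemma tensor_rep_class:
  assumes "t \<in> tensor_space sV sW"
  shows "tensor_class sV sW (tensor_rep t) = t"
proof -
  interpret F: vector_space fscale by (rule vector_space_fscale)
  obtain x where x: "t = tensor_class sV sW x" using assms by (auto simp: tensor_sub_def)
  have "tensor_rep t \<in> t"
    unfolding tensor_rep_def
    by (rule someI[of _ x]) (simp add: x tensor_class_def tensor_rel_def F.span_zero)
  then have "tensor_rep t - x \<in> tensor_rel sV sW" by (simp add: x tensor_class_def)
  then show ?thesis using x tensor_class_eq_iff[of sV sW "tensor_rep t" x] by simp
qed

definition trilin where
  "trilin sU sV sW s \<gamma> \<longleftrightarrow> (\<forall>v w. Vector_Spaces.linear sU s (\<lambda>u. \<gamma> u v w)) \<and>
     (\<forall>u w. Vector_Spaces.linear sV s (\<lambda>v. \<gamma> u v w)) \<and> (\<forall>u v. Vector_Spaces.linear sW s (\<gamma> u v))"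

text \<open>A trilinear map kills the generators of \<open>tensor3_rel\<close>. This turns an
  equality of cosets such as coassociativity into an equality of values.\<close>

lemma lin_ext_tensor3_class_eq:
  assumes "trilin sU sV sW s \<gamma>" and eq: "tensor3_class sU sV sW x = tensor3_class sU sV sW y"
  shows "lin_ext s (\<lambda>(u, v, w). \<gamma> u v w) x = lin_ext s (\<lambda>(u, v, w). \<gamma> u v w) y"
proof -
  have v: "vector_space s" using assms(1) unfolding trilin_def by (blast dest: linear_D(6))
  let ?L = "lin_ext s (\<lambda>(u, v, w). \<gamma> u v w)"
  interpret L: Vector_Spaces.linear fscale s ?L by (rule linear_lin_ext[OF v])
  interpret F: vector_space fscale by (rule vector_space_fscale)
  have a: "Vector_Spaces.linear sU s (\<lambda>u. \<gamma> u v w)" "Vector_Spaces.linear sV s (\<lambda>v. \<gamma> u v w)"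
     "Vector_Spaces.linear sW s (\<gamma> u v)" for u v w
    using assms by (auto simp: trilin_def)
  interpret s: vector_space s by fact
  have p: "?L (pure3 a b c) = \<gamma> a b c" for a b c
    by (simp add: pure3_def lin_ext_single[OF v])
  have "?L r = 0" if "r \<in> tensor3_rel sU sV sW" for r
    using that unfolding tensor3_rel_def
  proof (induction rule: F.span_induct_alt)
    case base show ?case by simp
  next
    case (step c x y)
    have "?L x = 0" using step(1)
      by (auto simp: L.diff L.scale p a[THEN linear_D(1)] a[THEN linear_D(2)])
    then show ?case using step(2) by (simp add: L.add L.scale)
  qed
  moreover have "x - y \<in> tensor3_rel sU sV sW" using eq by (simp add: tensor3_class_eq_iff)
  ultimately have "?L (x - y) = 0" by blast
  then show ?thesis by (simp add: L.diff)
qed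

lemma tensor_lift_tensor_mult:
  assumes "bilin sV sW s \<beta>"
  shows "tensor_lift s \<beta> (tensor_mult sV sW f g t t') =
    tensor_lift s (\<lambda>v w. tensor_lift s (\<lambda>v' w'. \<beta> (f v v') (g w w')) t') t"
proof -
  have v: "vector_space s" using assms unfolding bilin_def by (blast dest: linear_D(6))
  interpret s: vector_space s by fact
  show ?thesis
    by (simp add: tensor_mult_def tensor_lift_class[OF assms])
      (simp add: tensor_lift_lin_ext lin_ext_nested[OF v] pure_def lin_ext_single[OF v])
qed

lemma bilin_scale_left:
  assumes "vector_space sV" "Vector_Spaces.linear sW sK f" and "sK = (*)"
  shows "bilin sV sW sV (\<lambda>v w. sV (f w) v)"
proof -
  interpret vector_space sV by fact
  show ?thesis using assms
    by (auto simp: bilin_def Vector_Spaces.linear_iff vector_space_pair_def algebra_simps)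
qed

lemma bilin_scale_right:
  assumes "vector_space sW" "Vector_Spaces.linear sV sK f" and "sK = (*)"
  shows "bilin sV sW sW (\<lambda>v w. sW (f v) w)"
proof -
  interpret vector_space sW by fact
  show ?thesis using assms
    by (auto simp: bilin_def Vector_Spaces.linear_iff vector_space_pair_def algebra_simps)
qed

section \<open>Functionals and finite-dimensional subspaces\<close>

abbreviation functional :: "('k::field \<Rightarrow> 'v::ab_group_add \<Rightarrow> 'v) \<Rightarrow> ('v \<Rightarrow> 'k) \<Rightarrow> bool" where
  "functional s \<equiv> Vector_Spaces.linear s (*)"

lemma functionalI:
  assumes "vector_space s" "\<And>x y. f (x + y) = f x + f y" "\<And>c x. f (s c x) = c * f x"
  shows "functional s f"
  using assms vector_space_self by (simp add: Vector_Spaces.linear_iff vector_space_pair_def)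

lemma functional_comp:
  assumes L: "Vector_Spaces.linear s s' L" and f: "functional s' f"
  shows "functional s (\<lambda>x. f (L x))"
  by (rule functionalI) (simp_all add: linear_D[OF L] linear_D[OF f])

context vector_space
begin

lemma adapted_basis:
  assumes "subspace N"
  obtains B B0 where "independent B" "span B = UNIV" "B0 \<subseteq> B" "span B0 = N"
proof -
  obtain B0 where B0: "B0 \<subseteq> N" "independent B0" "N \<subseteq> span B0"
    using maximal_independent_subset by metis
  obtain B where B: "B0 \<subseteq> B" "independent B" "UNIV \<subseteq> span B"
    using maximal_independent_subset_extend[OF subset_UNIV B0(2)] by metis
  show thesis
  proof (rule that[of B B0])
    show "span B0 = N" using B0 span_minimal[OF B0(1) assms] by blast
  qed (use B in auto)
qed

lemma functional_representation:
  assumes "independent B" "span B = UNIV"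
  shows "functional scale (\<lambda>v. representation B v b)"
  by (rule functionalI) (use assms in \<open>auto simp: representation_add representation_scale vector_space_axioms\<close>)

lemma representation_eq_0_on_span:
  assumes "independent B" "B0 \<subseteq> B" "v \<in> span B0" "b \<notin> B0"
  shows "representation B v b = 0"
  using representation_extend[OF assms(1,3,2)] representation_ne_zero[of B0 v b] assms(4) by metis

text \<open>In a basis extending one of \<open>N\<close>, each coordinate outside the basis of
  \<open>N\<close> is a functional vanishing on \<open>N\<close>, so it vanishes at \<open>v\<close>
  too.\<close>

lemma mem_subspace_if_functionals:
  assumes N: "subspace N" and v: "\<And>f. functional scale f \<Longrightarrow> (\<And>n. n \<in> N \<Longrightarrow> f n = 0) \<Longrightarrow> f v = 0"
  shows "v \<in> N"
proof -
  obtain B B0 where B: "independent B" "span B = UNIV" "B0 \<subseteq> B" "span B0 = N"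
    using adapted_basis[OF N] .
  have "representation B v b = 0" if "b \<notin> B0" for b
    using v[OF functional_representation[OF B(1,2)]] representation_eq_0_on_span[OF B(1,3) _ that] B(4) by blast
  then have "{b. representation B v b \<noteq> 0} \<subseteq> N" using B(4) span_base by blast
  then have "(\<Sum>b | representation B v b \<noteq> 0. scale (representation B v b) b) \<in> N"
    by (intro subspace_sum[OF N] subspace_scale[OF N]) blast
  also have "(\<Sum>b | representation B v b \<noteq> 0. scale (representation B v b) b) = v"
    by (rule sum_nonzero_representation_eq) (use B in auto)
  finally show ?thesis .
qed

lemma eq_if_functionals:
  assumes "\<And>f. functional scale f \<Longrightarrow> f v = f w"
  shows "v = w"
proof -
  have "v - w \<in> {0}"
  proof (rule mem_subspace_if_functionals[OF subspace_single_0])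
    fix f assume f: "functional scale f"
    show "f (v - w) = 0" using assms[OF f] by (simp add: linear_D(3)[OF f])
  qed
  then show ?thesis by simp
qed

text \<open>A vector of \<open>V\<close> outside \<open>U\<close>, added to a basis of
  \<open>U\<close>, would give an independent set larger than a basis of \<open>V\<close>. The
  finite spanning set \<open>E\<close> makes all these bases finite.\<close>

lemma finite_dim_subspace_eqI:
  assumes "U \<subseteq> V" "subspace U" "V \<subseteq> span E" "finite E" "dim V \<le> dim U"
  shows "U = V"
proof (rule ccontr)
  assume "U \<noteq> V"
  obtain B where B: "B \<subseteq> U" "independent B" "U \<subseteq> span B" "card B = dim U" using basis_exists .
  obtain B' where B': "B' \<subseteq> V" "independent B'" "V \<subseteq> span B'" "card B' = dim V" using basis_exists .
  have "span B = U" using B assms(2) span_minimal by blast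
  then obtain v where v: "v \<in> V" "v \<notin> span B" using \<open>U \<noteq> V\<close> assms(1) by blast
  have fB': "finite B'" using independent_span_bound[OF assms(4) B'(2)] subset_trans[OF B'(1) assms(3)] by blast
  have "independent (insert v B)" using v B independent_insert by auto
  moreover have "insert v B \<subseteq> span B'" using v B B' assms(1) by auto
  ultimately have "finite (insert v B) \<and> card (insert v B) \<le> card B'"
    by (rule independent_span_bound[OF fB'])
  moreover have "v \<notin> B" using v span_base by auto
  ultimately show False using B(4) B'(4) assms(5) by auto
qed

text \<open>Least dimension yields minimality for inclusion, because all subspaces concerned lie in
  the span of \<open>E\<close>.\<close>

lemma minimal_finite_dim_subspace:
  assumes "P V0" "V0 \<subseteq> span E" "finite E" "\<And>V. P V \<Longrightarrow> subspace V"
  obtains V where "P V" "V \<subseteq> V0" "\<And>U. P U \<Longrightarrow> U \<subseteq> V \<Longrightarrow> U = V"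
proof -
  obtain V where V: "P V \<and> V \<subseteq> V0" "\<And>U. P U \<and> U \<subseteq> V0 \<Longrightarrow> dim V \<le> dim U"
    using ex_has_least_nat[of "\<lambda>V. P V \<and> V \<subseteq> V0" V0 dim] assms(1) by blast
  show thesis
  proof (rule that[of V])
    fix U assume "P U" "U \<subseteq> V"
    then show "U = V" using V assms by (intro finite_dim_subspace_eqI[of U V E]) auto
  qed (use V in auto)
qed

end

section \<open>Tensors determined by their slices\<close>

lemma subspace_tensor_rel_gens:
  fixes sV :: "'k::field \<Rightarrow> 'v::ab_group_add \<Rightarrow> 'v" and sW :: "'k \<Rightarrow> 'w::ab_group_add \<Rightarrow> 'w"
  shows "pure (v + v') w - pure v w - pure v' w \<in> tensor_rel sV sW"
    "pure v (w + w') - pure v w - pure v w' \<in> tensor_rel sV sW"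
    "pure (sV c v) w - fscale c (pure v w) \<in> tensor_rel sV sW"
    "pure v (sW c w) - fscale c (pure v w) \<in> tensor_rel sV sW"
  unfolding tensor_rel_def by (rule module.span_base[OF module_fscale], blast)+

lemma pure_lin_comb:
  fixes sV :: "'k::field \<Rightarrow> 'v::ab_group_add \<Rightarrow> 'v" and sW :: "'k \<Rightarrow> 'w::ab_group_add \<Rightarrow> 'w"
  assumes "vector_space sV" "vector_space sW" "finite I"
  shows "pure (\<Sum>i\<in>I. sV (c i) (v i)) w - (\<Sum>i\<in>I. fscale (c i) (pure (v i) w)) \<in> tensor_rel sV sW" (is ?L)
    and "pure u (\<Sum>i\<in>I. sW (c i) (y i)) - (\<Sum>i\<in>I. fscale (c i) (pure u (y i))) \<in> tensor_rel sV sW" (is ?R)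
proof -
  interpret F: vector_space fscale by (rule vector_space_fscale)
  interpret V: vector_space sV by fact
  interpret W: vector_space sW by fact
  note R = subspace_tensor_rel[of sV sW] and g = subspace_tensor_rel_gens[where sV = sV and sW = sW]
  show ?L using assms(3)
  proof induction
    case empty
    show ?case using g(3)[of 0 0 w] by simp
  next
    case (insert i I)
    let ?s = "\<Sum>i\<in>I. sV (c i) (v i)"
    show ?case
      using F.subspace_add[OF R F.subspace_add[OF R g(1)[of "sV (c i) (v i)" ?s w] g(3)[of "c i" "v i" w]] insert(3)] insert(1,2)
      by (simp add: algebra_simps)
  qed
  show ?R using assms(3)
  proof induction
    case empty
    show ?case using g(4)[of u 0 0] by simp
  next
    case (insert i I)
    let ?s = "\<Sum>i\<in>I. sW (c i) (y i)"
    show ?case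
      using F.subspace_add[OF R F.subspace_add[OF R g(2)[of u "sW (c i) (y i)" ?s] g(4)[of u "c i" "y i"]] insert(3)] insert(1,2)
      by (simp add: algebra_simps)
  qed
qed

lemma poly_mapping_sum_pure:
  "x = (\<Sum>p\<in>Poly_Mapping.keys x. fscale (Poly_Mapping.lookup x p) (pure (fst p) (snd p)))"
  by (rule poly_mapping_eqI)
    (auto simp: lookup_sum pure_def lookup_single when_def in_keys_iff sum.delta if_distrib cong: if_cong)

text \<open>Expanding every left component in \<open>B\<close> and collecting the terms at each
  basis vector \<open>b\<close> leaves \<open>b\<close> tensored with the slice \<open>w b\<close>
  along the coordinate functional of \<open>b\<close>.\<close>

lemma tensor_basis_expansion:
  assumes "vector_space sV" "vector_space sW" and t: "t \<in> tensor_space sV sW"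
    and B: "\<not> module.dependent sV B" "module.span sV B = UNIV"
  defines "w \<equiv> \<lambda>b. tensor_lift sW (\<lambda>v y. sW (module.representation sV B v b) y) t"
  obtains F where "finite F" "F \<subseteq> B" "\<And>b. b \<in> F \<Longrightarrow> w b \<noteq> 0" "t = tensor_class sV sW (\<Sum>b\<in>F. pure b (w b))"
proof -
  interpret F: vector_space fscale by (rule vector_space_fscale)
  interpret V: vector_space sV by fact
  interpret W: vector_space sW by fact
  define x where "x = tensor_rep t"
  let ?r = "V.representation B"
  \<comment> \<open>The finitely many basis vectors that occur in left components of the
    representative.\<close>
  define F where "F = (\<Union>p\<in>Poly_Mapping.keys x. {b. ?r (fst p) b \<noteq> 0})"
  have finF: "finite F" by (auto simp: F_def V.finite_representation)
  note R = subspace_tensor_rel[of sV sW]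
  have wb: "w b = (\<Sum>p\<in>Poly_Mapping.keys x. sW (Poly_Mapping.lookup x p * ?r (fst p) b) (snd p))" for b
    by (simp add: w_def tensor_lift_lin_ext lin_ext_def x_def)
  have repF: "fst p = (\<Sum>b\<in>F. sV (?r (fst p) b) b)" if "p \<in> Poly_Mapping.keys x" for p
  proof -
    have "fst p = (\<Sum>b | ?r (fst p) b \<noteq> 0. sV (?r (fst p) b) b)"
      by (rule V.sum_nonzero_representation_eq[OF B(1), symmetric]) (simp only: B(2) UNIV_I)
    also have "\<dots> = (\<Sum>b\<in>F. sV (?r (fst p) b) b)"
    proof (rule sum.mono_neutral_left[OF finF])
      show "{b. ?r (fst p) b \<noteq> 0} \<subseteq> F" using that unfolding F_def by blast
      show "\<forall>b\<in>F - {b. ?r (fst p) b \<noteq> 0}. sV (?r (fst p) b) b = 0"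
        by simp
    qed
    finally show ?thesis .
  qed
  have 1: "x - (\<Sum>p\<in>Poly_Mapping.keys x. fscale (Poly_Mapping.lookup x p) (\<Sum>b\<in>F. fscale (?r (fst p) b) (pure b (snd p)))) \<in> tensor_rel sV sW"
  proof -
    have "pure (fst p) (snd p) - (\<Sum>b\<in>F. fscale (?r (fst p) b) (pure b (snd p))) \<in> tensor_rel sV sW"
      if "p \<in> Poly_Mapping.keys x" for p
      using pure_lin_comb(1)[OF assms(1,2) finF, of "?r (fst p)" "\<lambda>b. b" "snd p"]
      by (simp only: repF[OF that, symmetric])
    then have "(\<Sum>p\<in>Poly_Mapping.keys x. fscale (Poly_Mapping.lookup x p)
      (pure (fst p) (snd p) - (\<Sum>b\<in>F. fscale (?r (fst p) b) (pure b (snd p))))) \<in> tensor_rel sV sW"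
      by (intro F.subspace_sum[OF R] F.subspace_scale[OF R])
    then show ?thesis
      by (simp only: F.scale_right_diff_distrib sum_subtractf flip: poly_mapping_sum_pure)
  qed
  have 2: "(\<Sum>b\<in>F. pure b (w b)) - (\<Sum>b\<in>F. \<Sum>p\<in>Poly_Mapping.keys x. fscale (Poly_Mapping.lookup x p * ?r (fst p) b) (pure b (snd p))) \<in> tensor_rel sV sW"
    unfolding sum_subtractf[symmetric] wb
    by (rule F.subspace_sum[OF R], rule pure_lin_comb(2)[OF assms(1,2)]) simp
  have 3: "(\<Sum>p\<in>Poly_Mapping.keys x. fscale (Poly_Mapping.lookup x p) (\<Sum>b\<in>F. fscale (?r (fst p) b) (pure b (snd p)))) =
    (\<Sum>b\<in>F. \<Sum>p\<in>Poly_Mapping.keys x. fscale (Poly_Mapping.lookup x p * ?r (fst p) b) (pure b (snd p)))"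
    by (subst sum.swap) (simp add: F.scale_sum_right)
  \<comment> \<open>Zero slices are discarded, so that a surviving \<open>b\<close> certifies
    \<open>w b\<close> to be nonzero; \<open>tensor_sub_if_slices\<close> uses this to place
    \<open>b\<close> in the basis of \<open>C\<close>.\<close>
  define F' where "F' = {b \<in> F. w b \<noteq> 0}"
  have p0: "pure b 0 \<in> tensor_rel sV sW" for b
    using subspace_tensor_rel_gens(4)[of b sW 0 0 sV] by simp
  have 4: "(\<Sum>b\<in>F. pure b (w b)) - (\<Sum>b\<in>F'. pure b (w b)) \<in> tensor_rel sV sW"
  proof -
    have "(\<Sum>b\<in>F. pure b (w b)) - (\<Sum>b\<in>F'. pure b (w b)) = (\<Sum>b\<in>F - F'. pure b (w b))"
      by (rule sum_diff[symmetric]) (use finF in \<open>auto simp: F'_def\<close>)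
    also have "\<dots> \<in> tensor_rel sV sW"
      by (rule F.subspace_sum[OF R]) (use p0 in \<open>auto simp: F'_def\<close>)
    finally show ?thesis .
  qed
  have "x - (\<Sum>b\<in>F'. pure b (w b)) \<in> tensor_rel sV sW"
    using F.subspace_add[OF R F.subspace_diff[OF R 1[unfolded 3] 2] 4] by simp
  then have eq: "t = tensor_class sV sW (\<Sum>b\<in>F'. pure b (w b))"
    using tensor_rep_class[OF t] tensor_class_eq_iff[of sV sW x] by (simp add: x_def)
  have "F \<subseteq> B" using V.representation_ne_zero by (auto simp: F_def)
  show thesis
  proof (rule that[OF _ _ _ eq])
    show "finite F'" "F' \<subseteq> B" using finF \<open>F \<subseteq> B\<close> by (auto simp: F'_def)
  qed (simp add: F'_def)
qed

text \<open>In a basis adapted to \<open>C\<close>, the right components are slices by coordinate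
  functionals and so lie in \<open>N\<close>. The slices by functionals on \<open>W\<close> lie in
  \<open>C\<close>, which makes the right components at basis vectors outside \<open>B0\<close>
  vanish.\<close>

lemma tensor_sub_if_slices:
  assumes vs: "vector_space sV" "vector_space sW" and t: "t \<in> tensor_space sV sW"
    and C: "module.subspace sV C" and N: "module.subspace sW N"
    and N_slice: "\<And>f. functional sV f \<Longrightarrow> tensor_lift sW (\<lambda>v w. sW (f v) w) t \<in> N"
    and C_slice: "\<And>g. functional sW g \<Longrightarrow> tensor_lift sV (\<lambda>v w. sV (g w) v) t \<in> C"
  shows "t \<in> tensor_sub sV sW C N"
proof -
  interpret V: vector_space sV by fact
  interpret W: vector_space sW by fact
  obtain B B0 where B: "V.independent B" "V.span B = UNIV" "B0 \<subseteq> B" "V.span B0 = C"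
    using V.adapted_basis[OF C] .
  let ?w = "\<lambda>b. tensor_lift sW (\<lambda>v y. sW (V.representation B v b) y) t"
  obtain F where F: "finite F" "F \<subseteq> B" "\<And>b. b \<in> F \<Longrightarrow> ?w b \<noteq> 0" "t = tensor_class sV sW (\<Sum>b\<in>F. pure b (?w b))"
  proof (rule tensor_basis_expansion[OF vs t B(1,2)])
    fix F assume F: "finite F" "F \<subseteq> B" "\<And>b. b \<in> F \<Longrightarrow> ?w b \<noteq> 0" "t = tensor_class sV sW (\<Sum>b\<in>F. pure b (?w b))"
    show thesis by (rule that[OF F])
  qed
  note fr = V.functional_representation[OF B(1,2)]
  have w0: "?w b = 0" if "b \<notin> B0" for b
  proof (rule W.eq_if_functionals)
    fix g assume g: "functional sW g"
    \<comment> \<open>Contracting both factors does not depend on the order: applying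
      \<open>g\<close> to the slice at \<open>b\<close> gives the \<open>b\<close>-coordinate of the
      slice along \<open>g\<close>.\<close>
    have "g (?w b) = lin_ext (*) (\<lambda>p. V.representation B (fst p) b * g (snd p)) (tensor_rep t)"
      using linear_D(2)[OF g] by (simp add: tensor_lift_lin_ext linear_commutes_lin_ext[OF g])
    also have "\<dots> = V.representation B (tensor_lift sV (\<lambda>v w. sV (g w) v) t) b"
      using linear_D(2)[OF fr] by (simp add: tensor_lift_lin_ext linear_commutes_lin_ext[OF fr] mult.commute)
    also have "\<dots> = 0"
      by (rule V.representation_eq_0_on_span[OF B(1,3) _ that]) (use C_slice[OF g] B(4) in simp)
    finally show "g (?w b) = g 0" by (simp add: linear_D(4)[OF g])
  qed
  have "Poly_Mapping.keys (pure b (?w b)) \<subseteq> C \<times> N" if "b \<in> F" for b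
  proof -
    have "b \<in> B0" using w0[of b] F(3)[OF that] by argo
    then have "b \<in> C" using V.span_base B(4) by blast
    then show ?thesis using N_slice[OF fr, of b] by (simp add: pure_def)
  qed
  then have "Poly_Mapping.keys (\<Sum>b\<in>F. pure b (?w b)) \<subseteq> C \<times> N"
    by (intro order_trans[OF keys_sum] UN_least)
  then show ?thesis using F(4) unfolding tensor_sub_def by blast
qed

section \<open>Comodules as modules over the dual of the coalgebra\<close>

text \<open>\<open>hit f m = f(m_{-1}) m_0\<close> and \<open>coef g m = m_{-1} g(m_0)\<close>; a subspace is a subcomodule iff it is stable
  under all \<open>hit f\<close>, which replaces computations in tensor products by linear algebra in \<open>M\<close>.\<close>

definition hit :: "('k::field \<Rightarrow> 'm::ab_group_add \<Rightarrow> 'm) \<Rightarrow> ('m \<Rightarrow> ('k, 'c, 'm) tensor) \<Rightarrow> ('c \<Rightarrow> 'k) \<Rightarrow> 'm \<Rightarrow> 'm" where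
  "hit sM \<rho> f m = tensor_lift sM (\<lambda>c n. sM (f c) n) (\<rho> m)"

definition coef :: "('k::field \<Rightarrow> 'c::ab_group_add \<Rightarrow> 'c) \<Rightarrow> ('m \<Rightarrow> ('k, 'c, 'm) tensor) \<Rightarrow> ('m \<Rightarrow> 'k) \<Rightarrow> 'm \<Rightarrow> 'c" where
  "coef sC \<rho> g m = tensor_lift sC (\<lambda>c n. sC (g n) c) (\<rho> m)"

lemma linear_tensor_lift:
  assumes \<rho>: "linear_into_tensor sM sV sW \<rho>" and M: "vector_space sM" and \<beta>: "bilin sV sW s \<beta>"
  shows "Vector_Spaces.linear sM s (\<lambda>m. tensor_lift s \<beta> (\<rho> m))"
proof -
  have v: "vector_space s" using \<beta> unfolding bilin_def by (blast dest: linear_D(6))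
  note L = linear_D(1,2)[OF linear_lin_ext[OF v]]
  have "tensor_lift s \<beta> (\<rho> (x + y)) = tensor_lift s \<beta> (\<rho> x) + tensor_lift s \<beta> (\<rho> y)" for x y
    using \<rho> by (simp add: linear_into_tensor_def tensor_add_def tensor_lift_class[OF \<beta>] L)
      (simp add: tensor_lift_lin_ext)
  moreover have "tensor_lift s \<beta> (\<rho> (sM c x)) = s c (tensor_lift s \<beta> (\<rho> x))" for c x
    using \<rho> by (simp add: linear_into_tensor_def tensor_scale_def tensor_lift_class[OF \<beta>] L)
      (simp add: tensor_lift_lin_ext)
  ultimately show ?thesis using M v by (simp add: Vector_Spaces.linear_iff vector_space_pair_def)
qed

definition costable where
  "costable sC sM \<rho> N \<longleftrightarrow> module.subspace sM N \<and> (\<forall>f n. functional sC f \<longrightarrow> n \<in> N \<longrightarrow> hit sM \<rho> f n \<in> N)"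

context left_comodule
begin

lemma coact_mem: "\<rho> m \<in> tensor_space sC sM"
  using coact_linear by (auto simp: linear_into_tensor_def)

lemma hit_linear: "functional sC f \<Longrightarrow> Vector_Spaces.linear sM sM (hit sM \<rho> f)"
  unfolding hit_def
  by (rule linear_tensor_lift[OF coact_linear M.vector_space_axioms bilin_scale_right[OF M.vector_space_axioms _ refl]])

lemma coef_linear: "functional sM g \<Longrightarrow> Vector_Spaces.linear sM sC (coef sC \<rho> g)"
  unfolding coef_def
  by (rule linear_tensor_lift[OF coact_linear M.vector_space_axioms bilin_scale_left[OF C.vector_space_axioms _ refl]])

text \<open>Both sides are f(m_{-1}) g(m_0). As functionals separate points, this duality transfers
  identities between \<open>hit\<close> and \<open>coef\<close>.\<close>

lemma functional_coef:
  assumes f: "functional sC f" and g: "functional sM g"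
  shows "f (coef sC \<rho> g m) = g (hit sM \<rho> f m)"
  by (simp add: coef_def hit_def tensor_lift_lin_ext linear_commutes_lin_ext[OF f]
      linear_commutes_lin_ext[OF g] linear_D(2)[OF f] linear_D(2)[OF g] mult.commute)

text \<open>Coassociativity in Sweedler form: \<gamma> is evaluated on m_{-2} \<otimes> m_{-1}
  \<otimes> m_0, computed in two ways.\<close>

lemma coassoc_trilinear:
  assumes \<gamma>: "trilin sC sC sM s \<gamma>"
  shows "tensor_lift s (\<lambda>c n. tensor_lift s (\<lambda>a b. \<gamma> a b n) (\<Delta> c)) (\<rho> m) =
    tensor_lift s (\<lambda>c n. tensor_lift s (\<lambda>a b. \<gamma> c a b) (\<rho> n)) (\<rho> m)"
proof -
  have v: "vector_space s" using \<gamma> unfolding trilin_def by (blast dest: linear_D(6))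
  interpret s: vector_space s by fact
  show ?thesis
    using lin_ext_tensor3_class_eq[OF \<gamma> coact_coassoc[of m, unfolded comult_tensor_id_def id_tensor_coact_def]]
    by (simp add: tensor_lift_lin_ext lin_ext_nested[OF v] pure3_def lin_ext_single[OF v] case_prod_unfold)
qed

lemma hit_counit: "hit sM \<rho> \<epsilon> m = m"
  unfolding hit_def by (rule coact_counit)

text \<open>The counit recovers \<open>g m\<close>, so a coefficient with \<open>g m\<close> nonzero
  is itself nonzero.\<close>

lemma counit_coef: "functional sM g \<Longrightarrow> \<epsilon> (coef sC \<rho> g m) = g m"
  using functional_coef[OF C.counit_linear] by (simp add: hit_counit)

text \<open>The right components of a single representative serve all \<open>f\<close> at once.
  Together with \<open>costable_orbit\<close> this is the local finiteness of comodules.\<close>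

lemma hit_in_finite_span: "\<exists>E. finite E \<and> (\<forall>f. hit sM \<rho> f m \<in> M.span E)"
proof (intro exI conjI allI)
  show "finite (snd ` Poly_Mapping.keys (tensor_rep (\<rho> m)))" by simp
  show "hit sM \<rho> f m \<in> M.span (snd ` Poly_Mapping.keys (tensor_rep (\<rho> m)))" for f
    unfolding hit_def tensor_lift_lin_ext
    by (rule lin_ext_mem[OF M.vector_space_axioms M.subspace_span]) (intro M.span_scale M.span_base imageI)
qed

lemma coef_in_finite_span: "\<exists>E. finite E \<and> (\<forall>g. coef sC \<rho> g m \<in> C.span E)"
proof (intro exI conjI allI)
  show "finite (fst ` Poly_Mapping.keys (tensor_rep (\<rho> m)))" by simp
  show "coef sC \<rho> g m \<in> C.span (fst ` Poly_Mapping.keys (tensor_rep (\<rho> m)))" for g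
    unfolding coef_def tensor_lift_lin_ext
    by (rule lin_ext_mem[OF C.vector_space_axioms C.subspace_span]) (intro C.span_scale C.span_base imageI)
qed

text \<open>Both sides are f(m_{-2}) m_{-1} g(m_0). Thus \<open>coef sC \<rho> g\<close> commutes
  with every \<open>hit\<close>: it is a comodule map from M to the coalgebra.\<close>

lemma hit_comult_coef:
  assumes f: "functional sC f" and g: "functional sM g"
  shows "hit sC \<Delta> f (coef sC \<rho> g m) = coef sC \<rho> g (hit sM \<rho> f m)"
proof -
  \<comment> \<open>The coalgebra is a left comodule over itself through \<Delta>, so the lemmas on
    \<open>hit\<close> apply to it.\<close>
  interpret self: left_comodule sC \<Delta> \<epsilon> sC \<Delta>
    using C.comult_linear C.coassoc C.counit_left by unfold_locales
  note lf = self.hit_linear[OF f] and lg = coef_linear[OF g]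
  let ?\<gamma> = "\<lambda>a b n. sC (f a * g n) b"
  have \<gamma>: "trilin sC sC sM sC ?\<gamma>"
    using f g M.vector_space_axioms C.vector_space_axioms
    by (auto simp: trilin_def Vector_Spaces.linear_iff vector_space_pair_def algebra_simps)
  have "hit sC \<Delta> f (coef sC \<rho> g m) = tensor_lift sC (\<lambda>c n. tensor_lift sC (\<lambda>a b. ?\<gamma> a b n) (\<Delta> c)) (\<rho> m)"
    unfolding coef_def tensor_lift_lin_ext[of _ _ "\<rho> m"] linear_commutes_lin_ext[OF lf] linear_D(2)[OF lf]
    by (simp add: hit_def tensor_lift_lin_ext lin_ext_def C.scale_sum_right ac_simps)
  also have "\<dots> = tensor_lift sC (\<lambda>c n. tensor_lift sC (\<lambda>a b. ?\<gamma> c a b) (\<rho> n)) (\<rho> m)"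
    by (rule coassoc_trilinear[OF \<gamma>])
  also have "\<dots> = coef sC \<rho> g (hit sM \<rho> f m)"
    unfolding hit_def tensor_lift_lin_ext[of _ _ "\<rho> m"] linear_commutes_lin_ext[OF lg] linear_D(2)[OF lg]
    by (simp add: coef_def tensor_lift_lin_ext lin_ext_def C.scale_sum_right ac_simps)
  finally show ?thesis .
qed

text \<open>Both sides are m_{-2} f(m_{-1}) g(m_0). Slicing a coefficient on the other side yields a
  coefficient of the same \<open>m\<close> for a new functional.\<close>

lemma coef_comult_coef:
  assumes f: "functional sC f" and g: "functional sM g"
  shows "coef sC \<Delta> f (coef sC \<rho> g m) = coef sC \<rho> (\<lambda>n. g (hit sM \<rho> f n)) m"
proof -
  interpret self: left_comodule sC \<Delta> \<epsilon> sC \<Delta>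
    using C.comult_linear C.coassoc C.counit_left by unfold_locales
  note lf = self.coef_linear[OF f]
  let ?\<gamma> = "\<lambda>a b n. sC (f b * g n) a"
  have \<gamma>: "trilin sC sC sM sC ?\<gamma>"
    using f g M.vector_space_axioms C.vector_space_axioms
    by (auto simp: trilin_def Vector_Spaces.linear_iff vector_space_pair_def algebra_simps)
  have "coef sC \<Delta> f (coef sC \<rho> g m) = tensor_lift sC (\<lambda>c n. tensor_lift sC (\<lambda>a b. ?\<gamma> a b n) (\<Delta> c)) (\<rho> m)"
    unfolding coef_def[of sC \<rho>] tensor_lift_lin_ext[of _ _ "\<rho> m"] linear_commutes_lin_ext[OF lf] linear_D(2)[OF lf]
    by (simp add: coef_def tensor_lift_lin_ext lin_ext_def C.scale_sum_right ac_simps)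
  also have "\<dots> = tensor_lift sC (\<lambda>c n. tensor_lift sC (\<lambda>a b. ?\<gamma> c a b) (\<rho> n)) (\<rho> m)"
    by (rule coassoc_trilinear[OF \<gamma>])
  also have "\<dots> = coef sC \<rho> (\<lambda>n. g (hit sM \<rho> f n)) m"
    by (simp add: coef_def hit_def tensor_lift_lin_ext linear_commutes_lin_ext[OF g] linear_D(2)[OF g])
     (simp add: lin_ext_def C.scale_sum_left)
  finally show ?thesis .
qed

text \<open>The functional on the right is a convolution product, c \<mapsto> f'(c_1) f(c_2). The
  identity is tested on functionals of M, where it reduces to
  \<open>hit_comult_coef\<close>.\<close>

lemma hit_hit:
  assumes f: "functional sC f" and f': "functional sC f'"
  shows "hit sM \<rho> f (hit sM \<rho> f' m) = hit sM \<rho> (\<lambda>c. f (hit sC \<Delta> f' c)) m"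
    and "functional sC (\<lambda>c. f (hit sC \<Delta> f' c))"
proof -
  interpret self: left_comodule sC \<Delta> \<epsilon> sC \<Delta>
    using C.comult_linear C.coassoc C.counit_left by unfold_locales
  show 1: "functional sC (\<lambda>c. f (hit sC \<Delta> f' c))"
    by (rule functional_comp[OF self.hit_linear[OF f'] f])
  show "hit sM \<rho> f (hit sM \<rho> f' m) = hit sM \<rho> (\<lambda>c. f (hit sC \<Delta> f' c)) m"
    by (rule M.eq_if_functionals)
      (simp add: functional_coef[symmetric] f f' 1 hit_comult_coef)
qed

lemma hit_lin_comb:
  "hit sM \<rho> (\<lambda>c. a * f c + b * f' c) m = sM a (hit sM \<rho> f m) + sM b (hit sM \<rho> f' m)"
  by (simp add: hit_def tensor_lift_lin_ext lin_ext_def M.scale_sum_right M.scale_left_distrib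
      M.scale_right_distrib sum.distrib mult.left_commute)

text \<open>Functionals are closed under linear combinations and, by \<open>hit_hit\<close>, under
  convolution. The orbit contains \<open>m\<close> itself, as the value at the counit.\<close>

lemma costable_orbit: "costable sC sM \<rho> {hit sM \<rho> f m | f. functional sC f}" (is "costable _ _ _ ?O")
proof -
  have lc: "functional sC (\<lambda>c. a * f c + b * f' c)" if f: "functional sC f" and f': "functional sC f'" for a b f f'
    by (rule functionalI[OF C.vector_space_axioms])
      (simp_all add: linear_D(1,2)[OF f] linear_D(1,2)[OF f'] algebra_simps)
  have comb: "sM a u + sM b v \<in> ?O" if u: "u \<in> ?O" and v: "v \<in> ?O" for a b u v
  proof -
    obtain f f' where f: "functional sC f" "u = hit sM \<rho> f m" and f': "functional sC f'" "v = hit sM \<rho> f' m"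
      using u v by blast
    show ?thesis
      by (rule CollectI, rule exI[of _ "\<lambda>c. a * f c + b * f' c"])
        (simp add: lc[OF f(1) f'(1)] hit_lin_comb f(2) f'(2))
  qed
  have ne: "m \<in> ?O"
    by (rule CollectI, rule exI[of _ \<epsilon>]) (simp add: C.counit_linear hit_counit)
  have sub: "M.subspace ?O"
    unfolding M.subspace_def
  proof (intro conjI ballI allI)
    show "0 \<in> ?O" using comb[OF ne ne, of 0 0] by simp
    show "x + y \<in> ?O" if "x \<in> ?O" "y \<in> ?O" for x y using comb[OF that, of 1 1] by simp
    show "sM c x \<in> ?O" if "x \<in> ?O" for x c using comb[OF that that, of c 0] by simp
  qed
  have "hit sM \<rho> f n \<in> ?O" if f: "functional sC f" and n: "n \<in> ?O" for f n
  proof -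
    obtain f' where f': "functional sC f'" "n = hit sM \<rho> f' m" using n by blast
    show ?thesis unfolding f'(2) hit_hit(1)[OF f f'(1)] using hit_hit(2)[OF f f'(1)] by blast
  qed
  then show ?thesis unfolding costable_def using sub by blast
qed

text \<open>The way back from \<open>hit\<close> to tensors, by which \<open>right_H_simple\<close>
  becomes applicable. Only the right slices carry a condition, since the left factor ranges over the
  whole coalgebra.\<close>

lemma subcomodule_if_costable:
  assumes "costable sC sM \<rho> N"
  shows "subcomodule sC sM \<rho> N"
  unfolding subcomodule_def
proof safe
  show N: "M.subspace N" using assms by (simp add: costable_def)
  fix n assume "n \<in> N"
  then have "hit sM \<rho> f n \<in> N" if "functional sC f" for f
    using assms that by (simp add: costable_def)
  then show "\<rho> n \<in> tensor_sub sC sM UNIV N"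
    unfolding hit_def
    by (intro tensor_sub_if_slices[OF C.vector_space_axioms M.vector_space_axioms coact_mem C.subspace_UNIV N] UNIV_I)
qed

text \<open>Any functional \<open>f\<close> sends the coefficient to
  \<open>g (hit sM \<rho> f w)\<close>, and \<open>g\<close> vanishes on \<open>N\<close>.\<close>

lemma coef_eq_0:
  assumes "costable sC sM \<rho> N" "functional sM g" "\<And>n. n \<in> N \<Longrightarrow> g n = 0" "w \<in> N"
  shows "coef sC \<rho> g w = 0"
proof (rule C.eq_if_functionals)
  fix f assume f: "functional sC f"
  have "g (hit sM \<rho> f w) = 0" using assms f by (simp add: costable_def)
  then show "f (coef sC \<rho> g w) = f 0"
    by (simp add: functional_coef[OF f assms(2)] linear_D(4)[OF f])
qed

end

lemma (in coalgebra) subcoalgebra_if_stable: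
  assumes "subspace D" "\<And>f x. functional s f \<Longrightarrow> x \<in> D \<Longrightarrow> hit s \<Delta> f x \<in> D"
    "\<And>f x. functional s f \<Longrightarrow> x \<in> D \<Longrightarrow> coef s \<Delta> f x \<in> D"
  shows "subcoalgebra s \<Delta> D"
proof -
  interpret self: left_comodule s \<Delta> \<epsilon> s \<Delta>
    using comult_linear coassoc counit_left by unfold_locales
  have "\<Delta> x \<in> tensor_sub s s D D" if x: "x \<in> D" for x
    by (rule tensor_sub_if_slices[OF vector_space_axioms vector_space_axioms self.coact_mem assms(1,1)])
      (fact assms(2,3)[OF _ x, unfolded hit_def coef_def])+
  then show ?thesis unfolding subcoalgebra_def using assms(1) by blast
qed

section \<open>Group-like elements\<close>

text \<open>\<open>\<Delta> g = g \<otimes> g\<close>, tested on bilinear maps into the coalgebra only.\<close>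

definition group_like where
  "group_like s \<Delta> g \<longleftrightarrow> g \<noteq> 0 \<and> (\<forall>\<beta>. bilin s s s \<beta> \<longrightarrow> tensor_lift s \<beta> (\<Delta> g) = \<beta> g g)"

lemma (in coalgebra) coalgebra_comodule: "left_comodule s \<Delta> \<epsilon> s \<Delta>"
  using comult_linear coassoc counit_left by unfold_locales

lemma hit_group_like:
  assumes "group_like s \<Delta> g" "functional s f"
  shows "hit s \<Delta> f g = s (f g) g"
  using assms bilin_scale_right[OF linear_D(5)[OF assms(2)] assms(2) refl] by (simp add: group_like_def hit_def)

text \<open>On a line spanned by d one has \<Delta> d = l (d \<otimes> d). The counit law gives l
  \<epsilon>(d) = 1, hence l is nonzero and l d is group-like.\<close>

lemma (in coalgebra) group_like_in_line:
  assumes D: "subcoalgebra s \<Delta> D" and dim: "dim D = 1"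
  obtains g where "g \<in> D" "group_like s \<Delta> g"
proof -
  have sub: "subspace D" using D by (simp add: subcoalgebra_def)
  obtain B where B: "B \<subseteq> D" "independent B" "D \<subseteq> span B" "card B = dim D" using basis_exists .
  then obtain d where d: "B = {d}" using dim by (metis card_1_singletonE)
  have d0: "d \<noteq> 0" using B(2) d by auto
  have dD: "d \<in> D" using B(1) d by simp
  have "\<forall>v\<in>D. \<exists>a. v = s a d" using B(3) unfolding d span_singleton by blast
  then obtain \<alpha> where \<alpha>: "\<And>v. v \<in> D \<Longrightarrow> v = s (\<alpha> v) d" by metis
  obtain x where x: "\<Delta> d = tensor_class s s x" "Poly_Mapping.keys x \<subseteq> D \<times> D"
    using D dD by (auto simp: subcoalgebra_def tensor_sub_def)
  \<comment> \<open>The scalar is read off a representative with all components on the line,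
    \<alpha> being the coordinate along \<open>d\<close>.\<close>
  define l where "l = (\<Sum>p\<in>Poly_Mapping.keys x. Poly_Mapping.lookup x p * (\<alpha> (fst p) * \<alpha> (snd p)))"
  have lift: "tensor_lift s \<beta> (\<Delta> d) = s l (\<beta> d d)" if \<beta>: "bilin s s s \<beta>" for \<beta>
  proof -
    have b: "\<beta> (s a v) (s b w) = s (a * b) (\<beta> v w)" for a b v w
      using \<beta> by (simp add: bilin_def Vector_Spaces.linear_iff)
    have "\<beta> (fst p) (snd p) = s (\<alpha> (fst p) * \<alpha> (snd p)) (\<beta> d d)" if "p \<in> Poly_Mapping.keys x" for p
    proof -
      have "fst p \<in> D" "snd p \<in> D" using that x(2) by auto
      then show ?thesis using b[of "\<alpha> (fst p)" d "\<alpha> (snd p)" d] \<alpha>[of "fst p"] \<alpha>[of "snd p"] by argo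
    qed
    then show ?thesis
      by (simp add: x(1) tensor_lift_class[OF \<beta>] lin_ext_def l_def scale_sum_left cong: sum.cong)
  qed
  have "bilin s s s (\<lambda>a b. s (\<epsilon> a) b)" by (rule bilin_scale_right[OF vector_space_axioms counit_linear refl])
  from lift[OF this] have "d = s (l * \<epsilon> d) d" by (simp add: counit_left)
  then have "l * \<epsilon> d = 1" using d0 by (metis scale_one scale_right_imp_eq)
  then have l0: "l \<noteq> 0" by auto
  have "group_like s \<Delta> (s l d)"
    unfolding group_like_def
  proof (intro conjI allI impI)
    show "s l d \<noteq> 0" using l0 d0 by simp
    fix \<beta> assume \<beta>: "bilin s s s \<beta>"
    have "tensor_lift s \<beta> (\<Delta> (s l d)) = s l (tensor_lift s \<beta> (\<Delta> d))"
      by (rule linear_D(2)[OF linear_tensor_lift[OF comult_linear vector_space_axioms \<beta>]])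
    also have "\<dots> = \<beta> (s l d) (s l d)"
      using \<beta> by (simp add: lift[OF \<beta>] bilin_def Vector_Spaces.linear_iff)
    finally show "tensor_lift s \<beta> (\<Delta> (s l d)) = \<beta> (s l d) (s l d)" .
  qed
  moreover have "s l d \<in> D" using sub dD by (rule subspace_scale)
  ultimately show thesis using that by blast
qed

text \<open>A nonzero subcoalgebra of \<open>C\<close> of least dimension is simple, hence a line by
  pointedness.\<close>

lemma (in coalgebra) group_like_in_subcoalgebra:
  assumes "pointed s \<Delta>" and C: "subcoalgebra s \<Delta> C" "C \<noteq> {0}" "C \<subseteq> span E" "finite E"
  obtains g where "g \<in> C" "group_like s \<Delta> g"
proof -
  obtain D where D: "subcoalgebra s \<Delta> D \<and> D \<noteq> {0}" "D \<subseteq> C"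
    "\<And>U. subcoalgebra s \<Delta> U \<and> U \<noteq> {0} \<Longrightarrow> U \<subseteq> D \<Longrightarrow> U = D"
    by (rule minimal_finite_dim_subspace[of "\<lambda>D. subcoalgebra s \<Delta> D \<and> D \<noteq> {0}" C E])
      (use C in \<open>auto simp: subcoalgebra_def\<close>)
  then have "simple_subcoalgebra s \<Delta> D" by (auto simp: simple_subcoalgebra_def)
  then have "dim D = 1" using assms(1) by (simp add: pointed_def)
  then show thesis using group_like_in_line[of D] D that by blast
qed

section \<open>Group-like eigenvectors modulo a subcomodule\<close>

lemma (in Vector_Spaces.linear) maps_span:
  assumes "\<And>x. x \<in> G \<Longrightarrow> f x \<in> vs2.span G'" "x \<in> vs1.span G"
  shows "f x \<in> vs2.span G'"
  using assms(2)
proof (induction rule: vs1.span_induct_alt)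
  case base show ?case by (simp add: zero vs2.span_zero)
next
  case (step c x y)
  then show ?case using assms(1) by (simp add: add scale vs2.span_add vs2.span_scale)
qed

context left_comodule
begin

text \<open>The orbit of some \<open>m\<close> outside \<open>N\<close> is costable and
  finite-dimensional; \<open>V\<close> has least dimension among its costable subspaces not
  contained in \<open>N\<close>.\<close>

lemma exists_minimal_costable:
  assumes "N \<noteq> UNIV"
  obtains V E where "costable sC sM \<rho> V" "\<not> V \<subseteq> N" "finite E" "V \<subseteq> M.span E"
    "\<forall>U. costable sC sM \<rho> U \<longrightarrow> U \<subseteq> V \<longrightarrow> U = V \<or> U \<subseteq> N"
proof -
  obtain m where m: "m \<notin> N" using assms by blast
  let ?O = "{hit sM \<rho> f m | f. functional sC f}"
  obtain E where E: "finite E" "\<And>f. hit sM \<rho> f m \<in> M.span E" using hit_in_finite_span by blast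
  have O: "?O \<subseteq> M.span E" using E(2) by blast
  have "m \<in> ?O" by (rule CollectI, rule exI[of _ \<epsilon>]) (simp add: C.counit_linear hit_counit)
  then have "costable sC sM \<rho> ?O \<and> \<not> ?O \<subseteq> N" using m costable_orbit by blast
  then obtain V where V: "costable sC sM \<rho> V \<and> \<not> V \<subseteq> N" "V \<subseteq> ?O"
    "\<And>U. costable sC sM \<rho> U \<and> \<not> U \<subseteq> N \<Longrightarrow> U \<subseteq> V \<Longrightarrow> U = V"
    by (rule M.minimal_finite_dim_subspace[OF _ O E(1)]) (auto simp: costable_def)
  show thesis
  proof (rule that[OF _ _ E(1)])
    show "V \<subseteq> M.span E" using V(2) O by (rule subset_trans)
    show "\<forall>U. costable sC sM \<rho> U \<longrightarrow> U \<subseteq> V \<longrightarrow> U = V \<or> U \<subseteq> N" using V(3) by blast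
  qed (use V(1) in blast)+
qed

text \<open>By \<open>hit_comult_coef\<close>, \<open>coef sC \<rho> g\<close> is a comodule map,
  and images, sums and preimages of costable subspaces are costable.\<close>

lemma costable_coef_image:
  assumes V: "costable sC sM \<rho> V" and U: "costable sC sC \<Delta> U" and g: "functional sM g"
  shows "costable sC sC \<Delta> {u + coef sC \<rho> g v | u v. u \<in> U \<and> v \<in> V}"
    and "costable sC sM \<rho> {v \<in> V. coef sC \<rho> g v \<in> U}"
proof -
  interpret L: Vector_Spaces.linear sM sC "coef sC \<rho> g" by (rule coef_linear[OF g])
  have sV: "M.subspace V" and sU: "C.subspace U" using V U by (auto simp: costable_def)
  have "{u + coef sC \<rho> g v | u v. u \<in> U \<and> v \<in> V} = {x + y | x y. x \<in> U \<and> y \<in> coef sC \<rho> g ` V}"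
    by blast
  then have sub: "C.subspace {u + coef sC \<rho> g v | u v. u \<in> U \<and> v \<in> V}"
    using C.subspace_sums[OF sU L.subspace_image[OF sV]] by simp
  have hv: "hit sM \<rho> f v \<in> V" if "functional sC f" "v \<in> V" for f v using V that by (simp add: costable_def)
  have hu: "hit sC \<Delta> f u \<in> U" if "functional sC f" "u \<in> U" for f u using U that by (simp add: costable_def)
  have "hit sC \<Delta> f (u + coef sC \<rho> g v) = hit sC \<Delta> f u + coef sC \<rho> g (hit sM \<rho> f v)" if f: "functional sC f" for f u v
    using left_comodule.hit_linear[OF C.coalgebra_comodule f] by (simp add: linear_D(1) hit_comult_coef[OF f g])
  then show "costable sC sC \<Delta> {u + coef sC \<rho> g v | u v. u \<in> U \<and> v \<in> V}"
    unfolding costable_def using sub hv hu by fastforce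
  have "M.subspace {v \<in> V. coef sC \<rho> g v \<in> U}"
    using sV sU by (auto simp: M.subspace_def C.subspace_def L.add L.scale L.zero)
  moreover have "coef sC \<rho> g (hit sM \<rho> f v) \<in> U" if f: "functional sC f" "coef sC \<rho> g v \<in> U" for f v
    unfolding hit_comult_coef[OF f(1) g, symmetric] by (rule hu[OF f])
  ultimately show "costable sC sM \<rho> {v \<in> V. coef sC \<rho> g v \<in> U}"
    unfolding costable_def using hv by blast
qed

end

context left_comodule
begin

text \<open>\<open>C\<close> is the coefficient space of \<open>V\<close> modulo \<open>N\<close>.
  Applying \<open>hit\<close> moves \<open>v\<close> inside \<open>V\<close>, and applying
  \<open>coef\<close> replaces \<open>g\<close> by its composite with a \<open>hit\<close>, which
  still vanishes on \<open>N\<close>.\<close>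

lemma coef_subcoalgebra:
  assumes N: "costable sC sM \<rho> N" and V: "costable sC sM \<rho> V" "\<not> V \<subseteq> N"
    and E: "finite E" "V \<subseteq> M.span E"
  defines "C \<equiv> C.span {coef sC \<rho> g v | g v. functional sM g \<and> (\<forall>n\<in>N. g n = 0) \<and> v \<in> V}"
  obtains F where "subcoalgebra sC \<Delta> C" "C \<noteq> {0}" "finite F" "C \<subseteq> C.span F"
proof -
  let ?G = "{coef sC \<rho> g v | g v. functional sM g \<and> (\<forall>n\<in>N. g n = 0) \<and> v \<in> V}"
  have G: "coef sC \<rho> g v \<in> C" if "functional sM g" "\<forall>n\<in>N. g n = 0" "v \<in> V" for g v
    unfolding C_def by (rule C.span_base) (use that in blast)
  have lin: "f x \<in> C" if "Vector_Spaces.linear sC sC f" "\<And>x. x \<in> ?G \<Longrightarrow> f x \<in> C" "x \<in> C" for f x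
    using that linear.maps_span[OF that(1), of ?G ?G x] unfolding C_def by blast
  have "hit sC \<Delta> f x \<in> C" if f: "functional sC f" and x: "x \<in> C" for f x
  proof (rule lin[OF left_comodule.hit_linear[OF C.coalgebra_comodule f] _ x])
    fix x assume "x \<in> ?G"
    then obtain g v where g: "functional sM g" "\<forall>n\<in>N. g n = 0" "v \<in> V" "x = coef sC \<rho> g v" by blast
    have "hit sM \<rho> f v \<in> V" using V(1) f g(3) by (simp add: costable_def)
    then show "hit sC \<Delta> f x \<in> C" unfolding g(4) hit_comult_coef[OF f g(1)] by (rule G[OF g(1,2)])
  qed
  moreover have "coef sC \<Delta> f x \<in> C" if f: "functional sC f" and x: "x \<in> C" for f x
  proof (rule lin[OF left_comodule.coef_linear[OF C.coalgebra_comodule f] _ x])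
    fix x assume "x \<in> ?G"
    then obtain g v where g: "functional sM g" "\<forall>n\<in>N. g n = 0" "v \<in> V" "x = coef sC \<rho> g v" by blast
    have "\<forall>n\<in>N. g (hit sM \<rho> f n) = 0" using N f g(2) by (simp add: costable_def)
    from G[OF functional_comp[OF hit_linear[OF f] g(1)] this g(3)]
    show "coef sC \<Delta> f x \<in> C" unfolding g(4) coef_comult_coef[OF f g(1)] .
  qed
  ultimately have sub: "subcoalgebra sC \<Delta> C"
    by (intro C.subcoalgebra_if_stable) (simp_all add: C_def)
  obtain v where v: "v \<in> V" "v \<notin> N" using V(2) by blast
  obtain g where g: "functional sM g" "\<forall>n\<in>N. g n = 0" "g v \<noteq> 0"
    using M.mem_subspace_if_functionals[of N v] N v(2) unfolding costable_def by blast
  have "coef sC \<rho> g v \<noteq> 0"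
  proof
    assume "coef sC \<rho> g v = 0"
    then have "\<epsilon> 0 = g v" using counit_coef[OF g(1), of v] by simp
    then show False using g(3) linear_D(4)[OF C.counit_linear] by simp
  qed
  then have ne: "C \<noteq> {0}" using G[OF g(1,2) v(1)] by blast
  \<comment> \<open>The finite set attached to \<open>e\<close> does not depend on \<open>g\<close>,
    so the union over \<open>E\<close> bounds all of \<open>C\<close>.\<close>
  obtain Ee where Ee: "\<And>e. finite (Ee e)" "\<And>e g. coef sC \<rho> g e \<in> C.span (Ee e)"
    using coef_in_finite_span by metis
  have "coef sC \<rho> g v \<in> C.span (\<Union>e\<in>E. Ee e)" if g: "functional sM g" and v: "v \<in> V" for g v
  proof (rule linear.maps_span[OF coef_linear[OF g]])
    show "coef sC \<rho> g e \<in> C.span (\<Union>e\<in>E. Ee e)" if "e \<in> E" for e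
      using Ee(2)[of g e] C.span_mono[of "Ee e" "\<Union>e\<in>E. Ee e"] that by blast
    show "v \<in> M.span E" using v E(2) by blast
  qed
  then have "C \<subseteq> C.span (\<Union>e\<in>E. Ee e)"
    unfolding C_def by (intro C.span_minimal) auto
  then show thesis using that[OF sub ne] E(1) Ee(1) by blast
qed

text \<open>The vector \<open>w\<close> has coefficient \<open>g\<close> modulo \<open>U\<close>,
  and \<open>g\<close> is an eigenvector of every \<open>hit\<close>. So
  \<open>hit sM \<rho> f w - sM (f g) w\<close> has its coefficient in \<open>U\<close>, and the
  vectors of \<open>V\<close> with this property lie in \<open>N\<close> by minimality of
  \<open>V\<close>.\<close>

lemma exists_group_like_eigenvector:
  assumes pointed: "pointed sC \<Delta>" and N: "costable sC sM \<rho> N" "N \<noteq> UNIV"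
  obtains w g where "w \<notin> N" "group_like sC \<Delta> g"
    "\<forall>f. functional sC f \<longrightarrow> hit sM \<rho> f w - sM (f g) w \<in> N"
proof -
  obtain V E where V: "costable sC sM \<rho> V" "\<not> V \<subseteq> N" and E: "finite E" "V \<subseteq> M.span E"
    and min: "\<forall>U. costable sC sM \<rho> U \<longrightarrow> U \<subseteq> V \<longrightarrow> U = V \<or> U \<subseteq> N"
    using exists_minimal_costable[OF N(2)] .
  define C where "C = C.span {coef sC \<rho> g v | g v. functional sM g \<and> (\<forall>n\<in>N. g n = 0) \<and> v \<in> V}"
  obtain F where C: "subcoalgebra sC \<Delta> C" "C \<noteq> {0}" and F: "finite F" "C \<subseteq> C.span F"
    using coef_subcoalgebra[OF N(1) V E] unfolding C_def .
  obtain g where gC: "g \<in> C" and g: "group_like sC \<Delta> g"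
    using C.group_like_in_subcoalgebra[OF pointed C F(2,1)] .
  define P where "P U \<longleftrightarrow> costable sC sC \<Delta> U \<and> U \<subseteq> C \<and> g \<notin> U" for U
  have "g \<noteq> 0" using g by (simp add: group_like_def)
  have P0: "P {0}"
    unfolding P_def costable_def
    using \<open>g \<noteq> 0\<close> C.subspace_0[of C] left_comodule.hit_linear[OF C.coalgebra_comodule, THEN linear_D(4)]
    by (auto simp: C_def C.span_zero)
  have bound: "C.dim U < Suc (card F)" if "P U" for U
    using that F(1) C.dim_le_card[OF subset_trans[OF _ F(2)] F(1), of U] unfolding P_def by auto
  \<comment> \<open>A left coideal in \<open>C\<close> avoiding \<open>g\<close>, of greatest
    dimension; dimensions are bounded because \<open>C\<close> lies in the span of the finite set
    \<open>F\<close>.\<close>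
  obtain U where U: "P U" and max: "\<And>U'. P U' \<Longrightarrow> C.dim U' \<le> C.dim U"
    using ex_has_greatest_nat[of P "{0}" C.dim "Suc (card F)"] P0 bound by (metis less_imp_le)
  have sU: "costable sC sC \<Delta> U" "C.subspace U" "U \<subseteq> C" "g \<notin> U" using U by (auto simp: P_def costable_def)
  have sV: "M.subspace V" using V by (simp add: costable_def)
  \<comment> \<open>Some coefficient lies outside \<open>U\<close>: otherwise \<open>U\<close> would
    contain the generators of \<open>C\<close>, hence \<open>g\<close>.\<close>
  obtain \<phi> v0 where \<phi>: "functional sM \<phi>" "\<And>n. n \<in> N \<Longrightarrow> \<phi> n = 0" and v0: "v0 \<in> V" "coef sC \<rho> \<phi> v0 \<notin> U"
  proof (rule ccontr)
    assume "\<not> thesis"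
    then have "{coef sC \<rho> g v | g v. functional sM g \<and> (\<forall>n\<in>N. g n = 0) \<and> v \<in> V} \<subseteq> U" using that by blast
    then have "C \<subseteq> U" unfolding C_def by (rule C.span_minimal[OF _ sU(2)])
    then show False using gC sU(4) by blast
  qed
  let ?U' = "{u + coef sC \<rho> \<phi> v | u v. u \<in> U \<and> v \<in> V}"
  have 0: "0 \<in> U" "0 \<in> V" using C.subspace_0[OF sU(2)] M.subspace_0[OF sV] by auto
  have \<phi>0: "coef sC \<rho> \<phi> 0 = 0" by (rule linear_D(4)[OF coef_linear[OF \<phi>(1)]])
  have U': "U \<subseteq> ?U'" "coef sC \<rho> \<phi> v0 \<in> ?U'" using 0 \<phi>0 v0(1) by force+
  have \<phi>C: "coef sC \<rho> \<phi> v \<in> C" if "v \<in> V" for v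
    unfolding C_def by (rule C.span_base) (use that \<phi> in blast)
  have CU': "?U' \<subseteq> C" using sU(3) \<phi>C C.subspace_add[of C] unfolding C_def by auto
  \<comment> \<open>Adding the coefficients along \<phi> enlarges \<open>U\<close> strictly, as
    \<open>v0\<close> shows, so by maximality the sum cannot avoid \<open>g\<close>.\<close>
  have "g \<in> ?U'"
  proof (rule ccontr)
    assume "g \<notin> ?U'"
    then have "P ?U'" unfolding P_def using costable_coef_image(1)[OF V(1) sU(1) \<phi>(1)] CU' by blast
    then have "U = ?U'"
      using max[OF \<open>P ?U'\<close>] C.finite_dim_subspace_eqI[OF U'(1) sU(2) subset_trans[OF CU' F(2)] F(1)] by blast
    then show False using U'(2) v0(2) by blast
  qed
  then obtain u w where uw: "u \<in> U" "w \<in> V" "g = u + coef sC \<rho> \<phi> w" by blast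
  have wU: "coef sC \<rho> \<phi> w \<notin> U" using uw sU(2,4) C.subspace_add by blast
  let ?V' = "{v \<in> V. coef sC \<rho> \<phi> v \<in> U}"
  \<comment> \<open>\<open>w\<close> lies in \<open>V\<close> but not in \<open>?V'\<close>: if its
    coefficient were in \<open>U\<close>, so would be \<open>g\<close>. Minimality then applies to
    the proper costable subspace \<open>?V'\<close>.\<close>
  have "?V' \<subseteq> N"
    using min costable_coef_image(2)[OF V(1) sU(1) \<phi>(1)] uw(2) wU by blast
  show thesis
  proof (rule that[OF _ g])
    show "w \<notin> N"
      using coef_eq_0[OF N(1) \<phi>] wU 0(1) by auto
    show "\<forall>f. functional sC f \<longrightarrow> hit sM \<rho> f w - sM (f g) w \<in> N"
    proof (intro allI impI)
      fix f assume f: "functional sC f"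
      interpret L: Vector_Spaces.linear sM sC "coef sC \<rho> \<phi>" by (rule coef_linear[OF \<phi>(1)])
      interpret H: Vector_Spaces.linear sC sC "hit sC \<Delta> f" by (rule left_comodule.hit_linear[OF C.coalgebra_comodule f])
      have w: "coef sC \<rho> \<phi> w = g - u" using uw(3) by simp
      have "hit sM \<rho> f w \<in> V" using V(1) f uw(2) by (simp add: costable_def)
      then have m: "hit sM \<rho> f w - sM (f g) w \<in> V"
        using uw(2) sV by (intro M.subspace_diff M.subspace_scale)
      \<comment> \<open>Substituting g - u for the coefficient of \<open>w\<close>, the two terms
        f(g) g cancel and only terms in \<open>u\<close> remain.\<close>
      have "coef sC \<rho> \<phi> (hit sM \<rho> f w - sM (f g) w) = sC (f g) u - hit sC \<Delta> f u"
        by (simp add: L.diff L.scale hit_comult_coef[OF f \<phi>(1), symmetric] w H.diff hit_group_like[OF g f]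
            C.scale_right_diff_distrib)
      also have "\<dots> \<in> U"
        using sU(1) f uw(1) by (intro C.subspace_diff[OF sU(2)] C.subspace_scale[OF sU(2)]) (auto simp: costable_def)
      finally show "hit sM \<rho> f w - sM (f g) w \<in> N" using m \<open>?V' \<subseteq> N\<close> by blast
    qed
  qed
qed

end

section \<open>Bases of right modules\<close>

context right_module
begin

lemma act_zero_left [simp]: "act 0 a = 0"
  using act_add_left[of 0 0 a] by simp

lemma act_zero_right [simp]: "act m 0 = 0"
  using act_add_right[of m 0 0] by simp

lemma act_minus_left: "act (- m) a = - act m a"
  using act_add_left[of m "- m" a] by (simp add: eq_neg_iff_add_eq_0 add.commute)

lemma act_minus_right: "act m (- a) = - act m a"
  using act_add_right[of m a "- a"] by (simp add: eq_neg_iff_add_eq_0 add.commute)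

lemma act_diff_left: "act (m - n) a = act m a - act n a"
  using act_add_left[of m "- n" a] by (simp add: act_minus_left)

lemma act_diff_right: "act m (a - b) = act m a - act m b"
  using act_add_right[of m a "- b"] by (simp add: act_minus_right)

lemma act_sum_left: "act (\<Sum>i\<in>I. f i) a = (\<Sum>i\<in>I. act (f i) a)"
  by (induction I rule: infinite_finite_induct) (simp_all add: act_add_left)

lemma act_sum_right: "act m (\<Sum>i\<in>I. f i) = (\<Sum>i\<in>I. act m (f i))"
  by (induction I rule: infinite_finite_induct) (simp_all add: act_add_right)

text \<open>The sum appearing in \<open>right_basis\<close>; \<open>rspan\<close> and
  \<open>rindep\<close> express existence and uniqueness of the coordinates there.\<close>

definition lcomb :: "('m \<Rightarrow>\<^sub>0 'a) \<Rightarrow> 'm" where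
  "lcomb c = (\<Sum>b\<in>Poly_Mapping.keys c. act b (Poly_Mapping.lookup c b))"

definition rspan :: "'m set \<Rightarrow> 'm set" where
  "rspan B = lcomb ` {c. Poly_Mapping.keys c \<subseteq> B}"

definition rindep :: "'m set \<Rightarrow> bool" where
  "rindep B \<longleftrightarrow> (\<forall>c. Poly_Mapping.keys c \<subseteq> B \<longrightarrow> lcomb c = 0 \<longrightarrow> c = 0)"

lemma lcomb_superset:
  "finite T \<Longrightarrow> Poly_Mapping.keys c \<subseteq> T \<Longrightarrow> lcomb c = (\<Sum>b\<in>T. act b (Poly_Mapping.lookup c b))"
  unfolding lcomb_def by (rule sum.mono_neutral_left) (auto simp: in_keys_iff)

lemma lcomb_add: "lcomb (c + d) = lcomb c + lcomb d"
proof -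
  let ?T = "Poly_Mapping.keys c \<union> Poly_Mapping.keys d"
  have "lcomb (c + d) = (\<Sum>b\<in>?T. act b (Poly_Mapping.lookup (c + d) b))"
    by (rule lcomb_superset) (use keys_add[of c d] in auto)
  also have "\<dots> = lcomb c + lcomb d"
    by (simp add: lcomb_superset[of ?T c] lcomb_superset[of ?T d] lookup_add act_add_right sum.distrib)
  finally show ?thesis .
qed

lemma lcomb_diff: "lcomb (c - d) = lcomb c - lcomb d"
  using lcomb_add[of "c - d" d] by (simp add: algebra_simps)

lemma lcomb_single: "lcomb (Poly_Mapping.single m a) = act m a"
  by (simp add: lcomb_def)

lemma rspan_zero: "0 \<in> rspan B"
  unfolding rspan_def by (rule image_eqI[of _ _ 0]) (simp_all add: lcomb_def)

lemma rspan_add: "x \<in> rspan B \<Longrightarrow> y \<in> rspan B \<Longrightarrow> x + y \<in> rspan B"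
proof -
  assume "x \<in> rspan B" "y \<in> rspan B"
  then obtain c d where c: "x = lcomb c" "Poly_Mapping.keys c \<subseteq> B" and d: "y = lcomb d" "Poly_Mapping.keys d \<subseteq> B"
    unfolding rspan_def by blast
  show ?thesis
    unfolding rspan_def c d by (rule image_eqI[of _ _ "c + d"]) (use keys_add[of c d] c d in \<open>auto simp: lcomb_add\<close>)
qed

lemma rspan_act: "x \<in> rspan B \<Longrightarrow> act x a \<in> rspan B"
proof -
  assume "x \<in> rspan B"
  then obtain c where c: "x = lcomb c" "Poly_Mapping.keys c \<subseteq> B" unfolding rspan_def by blast
  let ?d = "Poly_Mapping.map (\<lambda>y. y * a) c"
  have l: "Poly_Mapping.lookup ?d b = Poly_Mapping.lookup c b * a" for b
    by (simp add: Poly_Mapping.map.rep_eq when_def)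
  have k: "Poly_Mapping.keys ?d \<subseteq> Poly_Mapping.keys c" by (auto simp: in_keys_iff l)
  have "lcomb ?d = act x a"
    using lcomb_superset[OF finite_keys k] by (simp add: l c(1) lcomb_def act_sum_left act_mult)
  then show ?thesis unfolding rspan_def by (intro image_eqI[of _ _ ?d]) (use k c(2) in auto)
qed

lemma rspan_minus: "x \<in> rspan B \<Longrightarrow> - x \<in> rspan B"
  using rspan_act[of x B "- 1"] by (simp add: act_minus_right act_one)

lemma rspan_base: "b \<in> B \<Longrightarrow> b \<in> rspan B"
  unfolding rspan_def by (rule image_eqI[of _ _ "Poly_Mapping.single b 1"]) (auto simp: lcomb_single act_one)

lemma rspan_mono: "B \<subseteq> B' \<Longrightarrow> rspan B \<subseteq> rspan B'"
  unfolding rspan_def by blast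

lemma split_key:
  fixes c :: "'m \<Rightarrow>\<^sub>0 'a"
  assumes "Poly_Mapping.keys c \<subseteq> insert m B"
  obtains d where "Poly_Mapping.keys d \<subseteq> B" "c = Poly_Mapping.single m (Poly_Mapping.lookup c m) + d"
proof (rule that[of "c - Poly_Mapping.single m (Poly_Mapping.lookup c m)"])
  show "Poly_Mapping.keys (c - Poly_Mapping.single m (Poly_Mapping.lookup c m)) \<subseteq> B"
    using assms by (auto simp: in_keys_iff lookup_minus lookup_single when_def split: if_splits)
qed simp

lemma rspan_insert:
  assumes "x \<in> rspan (insert m B)"
  obtains a n where "n \<in> rspan B" "x = act m a + n"
proof -
  obtain c where c: "x = lcomb c" "Poly_Mapping.keys c \<subseteq> insert m B" using assms unfolding rspan_def by blast
  obtain d where d: "Poly_Mapping.keys d \<subseteq> B" "c = Poly_Mapping.single m (Poly_Mapping.lookup c m) + d"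
    using split_key[OF c(2)] .
  show thesis
  proof (rule that)
    show "lcomb d \<in> rspan B" using d(1) unfolding rspan_def by blast
    show "x = act m (Poly_Mapping.lookup c m) + lcomb d"
      unfolding c(1) by (subst d(2)) (simp only: lcomb_add lcomb_single)
  qed
qed

text \<open>In a relation over \<open>insert m B\<close>, the coefficient of \<open>m\<close>
  carries \<open>m\<close> into \<open>rspan B\<close>, hence is zero, and a relation over
  \<open>B\<close> remains.\<close>

lemma rindep_insert:
  assumes B: "rindep B" and m: "\<And>a. act m a \<in> rspan B \<Longrightarrow> a = 0"
  shows "rindep (insert m B)"
  unfolding rindep_def
proof (intro allI impI)
  fix c assume c: "Poly_Mapping.keys c \<subseteq> insert m B" "lcomb c = 0"
  obtain d where d: "Poly_Mapping.keys d \<subseteq> B" "c = Poly_Mapping.single m (Poly_Mapping.lookup c m) + d"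
    using split_key[OF c(1)] .
  have "act m (Poly_Mapping.lookup c m) = - lcomb d"
    using c(2) by (subst (asm) d(2)) (simp add: lcomb_add lcomb_single eq_neg_iff_add_eq_0)
  moreover have "- lcomb d \<in> rspan B" using d(1) rspan_minus unfolding rspan_def by blast
  ultimately have "Poly_Mapping.lookup c m = 0" using m by simp
  then have "c = d" using d(2) by simp
  then show "c = 0" using B d(1) c(2) by (simp add: rindep_def)
qed

lemma right_basisI:
  assumes "rindep B" "rspan B = UNIV"
  shows "right_basis act B"
  unfolding right_basis_def lcomb_def[symmetric]
proof
  fix m
  have "m \<in> rspan B" using assms(2) by simp
  then obtain c where c: "m = lcomb c" "Poly_Mapping.keys c \<subseteq> B" unfolding rspan_def by blast
  show "\<exists>!c. Poly_Mapping.keys c \<subseteq> B \<and> m = lcomb c"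
  proof (rule ex1I[of _ c])
    fix d assume d: "Poly_Mapping.keys d \<subseteq> B \<and> m = lcomb d"
    have "Poly_Mapping.keys (d - c) \<subseteq> B"
      using c(2) d by (auto simp: in_keys_iff lookup_minus subset_iff) (metis)
    moreover have "lcomb (d - c) = 0" using c d by (simp add: lcomb_diff)
    ultimately have "d - c = 0" using assms(1) unfolding rindep_def by blast
    then show "d = c" by simp
  qed (use c in auto)
qed

lemma rspan_Union_chain:
  assumes "subset.chain \<A> \<C>" "\<C> \<noteq> {}" "Poly_Mapping.keys c \<subseteq> \<Union>\<C>"
  obtains B where "B \<in> \<C>" "Poly_Mapping.keys c \<subseteq> B"
  using finite_subset_Union_chain[OF finite_keys assms(3,2,1)] by blast

end

section \<open>Extending independent sets in relative Hopf modules\<close>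

lemma (in hopf_algebra) group_like_left_inverse:
  assumes "group_like s \<Delta> g"
  obtains x where "x * g = 1"
proof -
  have g0: "g \<noteq> 0" using assms by (simp add: group_like_def)
  have "s (\<epsilon> g) g = g"
    using assms counit_left[of g] bilin_scale_right[OF vector_space_axioms counit_linear refl] by (simp add: group_like_def)
  then have "\<epsilon> g = 1" using g0 by (metis scale_one scale_right_imp_eq)
  moreover have "bilin s s s (\<lambda>a b. S a * b)"
    using antipode_linear
    by (auto simp: bilin_def Vector_Spaces.linear_iff algebra_simps
        scale_mult_left[symmetric] scale_mult_right[symmetric])
  then have "tensor_lift s (\<lambda>a b. S a * b) (\<Delta> g) = S g * g" using assms by (simp add: group_like_def)
  ultimately show thesis using that antipode_left[of g] by simp
qed

lemma (in k_algebra) functional_mult: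
  assumes f: "functional s f"
  shows "functional s (\<lambda>x. f (x * y))" "functional s (\<lambda>x. f (y * x))"
  by (rule functionalI[OF vector_space_axioms],
      simp_all add: linear_D(1,2)[OF f] algebra_simps scale_mult_left[symmetric] scale_mult_right[symmetric])+

context relative_hopf_module
begin

lemma act_scale_right: "act m (sA c a) = sM c (act m a)"
  using act_scale[of "act m a" c] act_mult[of m a "sA c 1"] A.scale_mult_right[of c a 1] by simp

lemma act_scale_left: "act (sM c m) a = sM c (act m a)"
proof -
  have "act (sM c m) a = act m (sA c 1 * a)" by (simp add: act_mult act_scale)
  also have "sA c 1 * a = sA c a" using A.scale_mult_left[of c 1 a] by simp
  finally show ?thesis by (simp add: act_scale_right)
qed

text \<open>Compatibility writes the left side as f(m_{-1} a_{-1}) m_0 a_0. Summing over the terms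
  of \<open>m\<close> first leaves a \<open>hit\<close> on \<open>m\<close> by a right translate of
  \<open>f\<close>.\<close>

lemma hit_act:
  assumes f: "functional sH f"
  shows "hit sM \<rho>M f (act m a) = tensor_lift sM (\<lambda>h b. act (hit sM \<rho>M (\<lambda>h'. f (h' * h)) m) b) (\<rho>A a)"
proof -
  have b: "bilin sH sM sM (\<lambda>c n. sM (f c) n)"
    by (rule bilin_scale_right[OF M.M.vector_space_axioms f refl])
  have "hit sM \<rho>M f (act m a) =
    tensor_lift sM (\<lambda>h' n. tensor_lift sM (\<lambda>h b. sM (f (h' * h)) (act n b)) (\<rho>A a)) (\<rho>M m)"
    unfolding hit_def coact_act by (rule tensor_lift_tensor_mult[OF b])
  also have "\<dots> = tensor_lift sM (\<lambda>h b. tensor_lift sM (\<lambda>h' n. sM (f (h' * h)) (act n b)) (\<rho>M m)) (\<rho>A a)"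
    unfolding tensor_lift_lin_ext lin_ext_def M.M.scale_sum_right
    by (subst sum.swap) (simp add: mult.left_commute)
  also have "\<dots> = tensor_lift sM (\<lambda>h b. act (hit sM \<rho>M (\<lambda>h'. f (h' * h)) m) b) (\<rho>A a)"
    by (simp add: hit_def tensor_lift_lin_ext lin_ext_def act_sum_left act_scale_left)
  finally show ?thesis .
qed

text \<open>Since \<rho>(w) is g \<otimes> w modulo H \<otimes> N, the value on
  \<open>act w a\<close> is f(g a_{-1}) w a_0 modulo \<open>N\<close>. The hypothesis on
  \<open>w\<close> is applied to the translates of \<open>f\<close> by the left components of
  \<open>a\<close>.\<close>

lemma hit_act_eigenvector:
  assumes f: "functional sH f" and N: "module.subspace sM N" "\<And>n a. n \<in> N \<Longrightarrow> act n a \<in> N"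
    and w: "\<forall>f. functional sH f \<longrightarrow> hit sM \<rho>M f w - sM (f g) w \<in> N"
  shows "hit sM \<rho>M f (act w a) - act w (hit sA \<rho>A (\<lambda>h. f (g * h)) a) \<in> N"
proof -
  let ?x = "tensor_rep (\<rho>A a)"
  have "hit sM \<rho>M f (act w a) - act w (hit sA \<rho>A (\<lambda>h. f (g * h)) a) =
    lin_ext sM (\<lambda>p. act (hit sM \<rho>M (\<lambda>h'. f (h' * fst p)) w - sM (f (g * fst p)) w) (snd p)) ?x"
    by (simp add: hit_act[OF f])
      (simp add: hit_def tensor_lift_lin_ext lin_ext_def act_sum_right act_scale_right act_diff_left act_scale_left
        M.M.scale_right_diff_distrib sum_subtractf)
  also have "\<dots> \<in> N"
    by (rule lin_ext_mem[OF M.M.vector_space_axioms N(1)], rule N(2))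
      (use w H.functional_mult(1)[OF f] in blast)
  finally show ?thesis .
qed

end

context relative_hopf_module
begin

lemma costable_annihilator:
  assumes N: "costable sH sM \<rho>M N" "\<And>n a. n \<in> N \<Longrightarrow> act n a \<in> N"
    and g: "group_like sH \<Delta> g"
    and w: "\<forall>f. functional sH f \<longrightarrow> hit sM \<rho>M f w - sM (f g) w \<in> N"
  shows "costable sH sA \<rho>A {a. act w a \<in> N}"
proof -
  have sN: "M.M.subspace N" using N(1) by (simp add: costable_def)
  have sub: "A.subspace {a. act w a \<in> N}"
    using sN by (auto simp: A.subspace_def M.M.subspace_def act_add_right act_scale_right)
  obtain x where x: "x * g = 1" using H.group_like_left_inverse[OF g] .
  have "act w (hit sA \<rho>A f a) \<in> N" if f: "functional sH f" and a: "act w a \<in> N" for f a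
  proof -
    \<comment> \<open>Translating \<open>f\<close> by the inverse of \<open>g\<close> beforehand
      cancels the twist by \<open>g\<close> from \<open>hit_act_eigenvector\<close>.\<close>
    let ?f = "\<lambda>h. f (x * h)"
    have f': "functional sH ?f" by (rule H.functional_mult(2)[OF f])
    have "(\<lambda>h. ?f (g * h)) = f" by (simp add: mult.assoc[symmetric] x)
    then have "hit sM \<rho>M ?f (act w a) - act w (hit sA \<rho>A f a) \<in> N"
      using hit_act_eigenvector[OF f' sN N(2) w, of a] by simp
    moreover have "hit sM \<rho>M ?f (act w a) \<in> N" using N(1) f' a by (simp add: costable_def)
    ultimately show ?thesis using M.M.subspace_diff[OF sN] by fastforce
  qed
  then show ?thesis unfolding costable_def using sub by blast
qed

lemma subspace_rspan: "M.M.subspace (rspan B)"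
  unfolding M.M.subspace_def using rspan_zero rspan_add rspan_act[of _ B "sA _ 1"]
  by (auto simp: act_scale)

lemma costable_rspan_insert:
  assumes N: "costable sH sM \<rho>M (rspan B)"
    and w: "\<forall>f. functional sH f \<longrightarrow> hit sM \<rho>M f w - sM (f g) w \<in> rspan B"
  shows "costable sH sM \<rho>M (rspan (insert w B))"
proof -
  have mono: "n \<in> rspan (insert w B)" if "n \<in> rspan B" for n using that rspan_mono[of B "insert w B"] by blast
  have "hit sM \<rho>M f x \<in> rspan (insert w B)" if f: "functional sH f" and "x \<in> rspan (insert w B)" for f x
  proof -
    obtain a n where an: "n \<in> rspan B" "x = act w a + n" using rspan_insert[OF \<open>x \<in> _\<close>] .
    let ?b = "hit sA \<rho>A (\<lambda>h. f (g * h)) a"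
    have "hit sM \<rho>M f (act w a) - act w ?b \<in> rspan B"
      by (rule hit_act_eigenvector[OF f subspace_rspan rspan_act w])
    moreover have "hit sM \<rho>M f n \<in> rspan B" using N f an(1) by (simp add: costable_def)
    ultimately have "(hit sM \<rho>M f (act w a) - act w ?b) + hit sM \<rho>M f n \<in> rspan (insert w B)"
      using mono rspan_add by blast
    moreover have "act w ?b \<in> rspan (insert w B)" by (intro rspan_act rspan_base) simp
    ultimately have "act w ?b + ((hit sM \<rho>M f (act w a) - act w ?b) + hit sM \<rho>M f n) \<in> rspan (insert w B)"
      using rspan_add by blast
    then show ?thesis by (simp add: an(2) linear_D(1)[OF M.hit_linear[OF f]])
  qed
  then show ?thesis unfolding costable_def using subspace_rspan by blast
qed

lemma free_if_pointed_simple: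
  assumes pointed: "pointed sH \<Delta>" and simple: "right_H_simple sH sA \<rho>A"
  shows "free_right_module act"
proof -
  let ?A = "{B. rindep B \<and> costable sH sM \<rho>M (rspan B)}"
  \<comment> \<open>Zorn's lemma needs the union of every chain. The empty chain gives the empty
    set, with span 0; in a nonempty one, each linear combination already lives in one
    member.\<close>
  have chain: "\<Union>\<C> \<in> ?A" if \<C>: "subset.chain ?A \<C>" for \<C>
  proof (cases "\<C> = {}")
    case True
    have "rspan {} = {0}" by (auto simp: rspan_def lcomb_def)
    moreover have "hit sM \<rho>M f 0 = 0" if "functional sH f" for f
      by (rule linear_D(4)[OF M.hit_linear[OF that]])
    ultimately show ?thesis using True subspace_rspan[of "{}"] by (simp add: rindep_def costable_def)
  next
    case False
    have mem: "rindep B" "costable sH sM \<rho>M (rspan B)" if "B \<in> \<C>" for B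
      using \<C> that by (auto simp: subset.chain_def)
    have "rindep (\<Union>\<C>)"
      unfolding rindep_def
    proof (intro allI impI)
      fix c assume "Poly_Mapping.keys c \<subseteq> \<Union>\<C>" "lcomb c = 0"
      moreover obtain B where "B \<in> \<C>" "Poly_Mapping.keys c \<subseteq> B"
        using rspan_Union_chain[OF \<C> False] calculation(1) by blast
      ultimately show "c = 0" using mem(1) unfolding rindep_def by blast
    qed
    moreover have "hit sM \<rho>M f x \<in> rspan (\<Union>\<C>)" if f: "functional sH f" and "x \<in> rspan (\<Union>\<C>)" for f x
    proof -
      obtain c where c: "x = lcomb c" "Poly_Mapping.keys c \<subseteq> \<Union>\<C>" using \<open>x \<in> _\<close> unfolding rspan_def by blast
      obtain B where B: "B \<in> \<C>" "Poly_Mapping.keys c \<subseteq> B" using rspan_Union_chain[OF \<C> False c(2)] .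
      have "x \<in> rspan B" using c(1) B(2) unfolding rspan_def by blast
      then have "hit sM \<rho>M f x \<in> rspan B" using mem(2)[OF B(1)] f by (simp add: costable_def)
      then show ?thesis using rspan_mono[of B "\<Union>\<C>"] B(1) by blast
    qed
    ultimately show ?thesis using subspace_rspan by (simp add: costable_def)
  qed
  obtain B where B: "rindep B" "costable sH sM \<rho>M (rspan B)"
    and max: "\<And>B'. B' \<in> ?A \<Longrightarrow> B \<subseteq> B' \<Longrightarrow> B' = B"
    using subset_Zorn'[OF chain] by blast
  have "rspan B = UNIV"
  proof (rule ccontr)
    assume "rspan B \<noteq> UNIV"
    then obtain w g where wg: "w \<notin> rspan B" "group_like sH \<Delta> g"
      "\<forall>f. functional sH f \<longrightarrow> hit sM \<rho>M f w - sM (f g) w \<in> rspan B"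
      using M.exists_group_like_eigenvector[OF pointed B(2)] by blast
    let ?I = "{a. act w a \<in> rspan B}"
    have "subcomodule sH sA \<rho>A ?I"
      by (rule subcomodule_if_costable[OF costable_annihilator[OF B(2) rspan_act wg(2,3)]])
    moreover have "right_ideal ?I"
      using rspan_act M.M.subspace_diff[OF subspace_rspan] by (auto simp: right_ideal_def rspan_zero act_diff_right act_mult)
    \<comment> \<open>The unit is not in \<open>?I\<close>, because \<open>act w 1\<close> is
      \<open>w\<close>, which is outside \<open>rspan B\<close>.\<close>
    moreover have "?I \<noteq> UNIV" using wg(1) act_one[of w] by (metis UNIV_I mem_Collect_eq)
    ultimately have I: "?I = {0}" using simple by (auto simp: right_H_simple_def)
    \<comment> \<open>With \<open>?I\<close> zero, \<open>w\<close> has no nonzero annihilator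
      modulo \<open>rspan B\<close>; this contradicts maximality of \<open>B\<close>.\<close>
    have "insert w B \<in> ?A"
      using rindep_insert[OF B(1), of w] I costable_rspan_insert[OF B(2) wg(3)] by blast
    then have "insert w B = B" using max by blast
    then show False using wg(1) rspan_base by blast
  qed
  then show ?thesis unfolding free_right_module_def using right_basisI[OF B(1)] by blast
qed

end

theorem theorem4p6:
  fixes sH :: "'k::field \<Rightarrow> 'h::{ring,monoid_mult} \<Rightarrow> 'h"
    and \<Delta> :: "'h \<Rightarrow> ('k, 'h, 'h) tensor" and \<epsilon> :: "'h \<Rightarrow> 'k" and S :: "'h \<Rightarrow> 'h"
    and sA :: "'k \<Rightarrow> 'a::{ring,monoid_mult} \<Rightarrow> 'a"
    and \<rho>A :: "'a \<Rightarrow> ('k, 'h, 'a) tensor"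
    and sM :: "'k \<Rightarrow> 'm::ab_group_add \<Rightarrow> 'm"
    and \<rho>M :: "'m \<Rightarrow> ('k, 'h, 'm) tensor"
    and act :: "'m \<Rightarrow> 'a \<Rightarrow> 'm"
  assumes "hopf_algebra sH \<Delta> \<epsilon> S"
    and "left_comodule_algebra sH \<Delta> \<epsilon> S sA \<rho>A"
    and "pointed sH \<Delta>"
    and "right_H_simple sH sA \<rho>A"
    and "relative_hopf_module sH \<Delta> \<epsilon> S sA \<rho>A sM \<rho>M act"
  shows "free_right_module act"
  using assms(5,3,4) by (rule relative_hopf_module.free_if_pointed_simple)

end
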